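(* Let $W$ be a finite-dimensional real vector space. Every finite polytopal complex in $W$ admits a polytopal completion that is locally finite in $W$.
   Context: A polytope is a bounded polyhedron. A polyhedral complex in $W$ is a (not necessarily finite) collection of polyhedra closed under taking faces such that any two non-disjoint members intersect in a face of each; it is polytopal if all members are polytopes. A completion of a complex $\Phi$ is a polyhedral complex containing $\Phi$ as a subcomplex whose union is all of $W$; a polytopal completion is a completion that is a polytopal complex. A family of subsets is locally finite in $W$ if every point of $W$ has a neighborhood meeting only finitely many members. *)

theory Defs
  imports "HOL-Analysis.Analysis"
begin

text \<open>
  The ambient space of a complex is a linear subspace \<open>W\<close> of a Euclidean space rather than a whole
  type: types of class \<open>euclidean_space\<close> have positive dimension, whereas \<open>W = {0}\<close> is also
  a subspace.  A polyhedron in \<open>W\<close> is a \<open>polyhedron\<close> of the Euclidean space contained in \<open>W\<close>.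

  In the library \<open>{} face_of S\<close> always holds.  Only nonempty faces are required to be members
  here, and the empty polyhedron is allowed but not required as a member; so complexes with and
  without the empty set are both covered.
\<close>

definition polyhedral_complex :: "'a::euclidean_space set \<Rightarrow> 'a set set \<Rightarrow> bool" where
  "polyhedral_complex W \<Phi> \<longleftrightarrow>
     (\<forall>P\<in>\<Phi>. polyhedron P \<and> P \<subseteq> W) \<and>
     (\<forall>P\<in>\<Phi>. \<forall>F. F face_of P \<and> F \<noteq> {} \<longrightarrow> F \<in> \<Phi>) \<and>
     (\<forall>P\<in>\<Phi>. \<forall>Q\<in>\<Phi>. P \<inter> Q \<noteq> {} \<longrightarrow> (P \<inter> Q) face_of P \<and> (P \<inter> Q) face_of Q)"

text \<open>A polytope is a bounded polyhedron by \<open>polytope_eq_bounded_polyhedron\<close>.\<close>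

definition polytopal_complex :: "'a::euclidean_space set \<Rightarrow> 'a set set \<Rightarrow> bool" where
  "polytopal_complex W \<Phi> \<longleftrightarrow> polyhedral_complex W \<Phi> \<and> (\<forall>P\<in>\<Phi>. polytope P)"

definition subcomplex :: "'a::euclidean_space set \<Rightarrow> 'a set set \<Rightarrow> 'a set set \<Rightarrow> bool" where
  "subcomplex W \<Phi> \<Psi> \<longleftrightarrow> \<Phi> \<subseteq> \<Psi> \<and> polyhedral_complex W \<Phi> \<and> polyhedral_complex W \<Psi>"

definition completion :: "'a::euclidean_space set \<Rightarrow> 'a set set \<Rightarrow> 'a set set \<Rightarrow> bool" where
  "completion W \<Phi> \<Psi> \<longleftrightarrow> polyhedral_complex W \<Psi> \<and> subcomplex W \<Phi> \<Psi> \<and> \<Union>\<Psi> = W"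

definition polytopal_completion :: "'a::euclidean_space set \<Rightarrow> 'a set set \<Rightarrow> 'a set set \<Rightarrow> bool" where
  "polytopal_completion W \<Phi> \<Psi> \<longleftrightarrow> completion W \<Phi> \<Psi> \<and> polytopal_complex W \<Psi>"

end

theory Submission
  imports Defs
begin

text \<open>
  Cells are added to a locally finite polytopal completion one at a time, by nondecreasing
  dimension, starting from a cube grid.  Only \<^emph>\<open>cellulations\<close> (polytopes with disjoint relative
  interiors, each boundary a union of smaller cells, not necessarily face-to-face) have to be
  built: coning each cell from a relative interior point, in order of increasing dimension and
  leaving a chosen subcomplex untouched, makes a cellulation face-to-face.

  To add \<open>P\<close> to a completion of \<open>\<Phi>\<close> containing all proper faces of \<open>P\<close>, cone twice: first with
  apexes on \<open>P\<close> wherever possible, which turns \<open>P\<close> into a union of cells, then once more, after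
  which every cell meeting the relative interior of \<open>P\<close> meets \<open>\<Phi>\<close> only inside \<open>P\<close>.  Choose a thin
  convex neighbourhood \<open>Q\<close> of \<open>P\<close>, bounded by hyperplanes supporting \<open>P\<close>; together with hyperplanes
  through \<open>P\<close> these form an arrangement in which \<open>P\<close> is a cell and which does not cut the boundary
  of \<open>P\<close>.  Use the arrangement itself inside \<open>Q\<close>, and its intersections with the old cells for
  those old cells that meet \<open>\<Phi>\<close> only inside \<open>P\<close>; the other cells remain.  This is a cellulation
  containing \<open>\<Phi>\<close> and \<open>P\<close>.
\<close>

section \<open>Polytopes and cellulations\<close>

text \<open>Induction on dimension: a point of a polytope outside its relative interior lies on a
  proper face, and proper faces have smaller dimension.\<close>

lemma exists_face_rel_interior:
  fixes C :: "'a::euclidean_space set"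
  assumes "polytope C" "x \<in> C"
  shows "\<exists>F. F face_of C \<and> x \<in> rel_interior F"
  using assms
proof (induction C rule: measure_induct_rule[where f = "\<lambda>C. nat (aff_dim C + 1)"])
  case (less C)
  have poly: "polyhedron C"
    using less.prems polytope_imp_polyhedron by blast
  show ?case
  proof (cases "x \<in> rel_interior C")
    case True
    then show ?thesis
      using face_of_refl less.prems(1) polytope_imp_convex by blast
  next
    case False
    then have "x \<in> rel_frontier C"
      using less.prems closure_subset by (auto simp: rel_frontier_def)
    then obtain F where F: "F face_of C" "F \<noteq> C" "x \<in> F"
      using rel_frontier_of_polyhedron_alt[OF poly] by auto
    have "aff_dim F < aff_dim C"
      using F face_of_aff_dim_lt less.prems(1) polytope_imp_convex by blast
    moreover have "aff_dim F \<ge> 0"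
      using F by (metis aff_dim_negative_iff empty_iff not_le)
    ultimately have "nat (aff_dim F + 1) < nat (aff_dim C + 1)"
      by linarith
    then obtain G where "G face_of F" "x \<in> rel_interior G"
      using less.IH F face_of_polytope_polytope less.prems(1) by blast
    then show ?thesis
      using F face_of_trans by blast
  qed
qed

text \<open>A face that meets the relative interior of a convex subset contains the whole subset.
  This is applied to the face whose relative interior contains a chosen relative interior point of
  \<open>X\<close>.\<close>

lemma subset_proper_face:
  fixes C :: "'a::euclidean_space set"
  assumes "polytope C" "convex X" "X \<noteq> {}" "X \<subseteq> C" "X \<inter> rel_interior C = {}"
  shows "\<exists>F. F face_of C \<and> F \<noteq> C \<and> X \<subseteq> F"
proof -
  obtain x where x: "x \<in> rel_interior X"
    using assms(2,3) rel_interior_eq_empty by blast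
  then have "x \<in> X"
    using rel_interior_subset by blast
  then obtain F where F: "F face_of C" "x \<in> rel_interior F"
    using exists_face_rel_interior assms by blast
  have "F \<noteq> C"
    using F \<open>x \<in> X\<close> assms(5) by blast
  moreover have "X \<subseteq> F"
    using subset_of_face_of[OF F(1) assms(4)] F(2) x rel_interior_subset by blast
  ultimately show ?thesis
    using F(1) by blast
qed

text \<open>The affine hull of a proper face misses the relative interior. Hence coning a piece of
  the boundary from a relative interior point always gives a genuine pyramid.\<close>

lemma notin_affine_hull_frontier_subset:
  fixes C :: "'a::euclidean_space set"
  assumes "polytope C" "convex X" "X \<subseteq> C" "X \<inter> rel_interior C = {}" "c \<in> rel_interior C"
  shows "c \<notin> affine hull X"
proof (cases "X = {}")
  case False
  then obtain F where F: "F face_of C" "F \<noteq> C" "X \<subseteq> F"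
    using subset_proper_face[OF assms(1-2) _ assms(3-4)] by blast
  then have "affine hull F \<inter> rel_interior C = {}"
    using affine_hull_face_of_disjoint_rel_interior assms(1) polytope_imp_convex by blast
  then show ?thesis
    using F(3) assms(5) hull_mono by blast
qed simp

lemma in_rel_interior_segment:
  fixes C :: "'a::euclidean_space set"
  assumes "convex C" "c \<in> rel_interior C" "x \<in> C" "0 < t" "t \<le> 1"
  shows "(1 - t) *\<^sub>R x + t *\<^sub>R c \<in> rel_interior C"
  using rel_interior_convex_shrink[OF assms] by (simp add: algebra_simps)

section \<open>Pyramids over polytopes\<close>

lemma in_convex_hull_insert_iff:
  fixes X :: "'a::real_vector set"
  assumes "convex X" "X \<noteq> {}"
  shows "z \<in> convex hull (insert a X) \<longleftrightarrow>
    (\<exists>x\<in>X. \<exists>t. 0 \<le> t \<and> t \<le> 1 \<and> z = (1 - t) *\<^sub>R x + t *\<^sub>R a)"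
proof -
  have "z \<in> convex hull (insert a X) \<longleftrightarrow>
    (\<exists>u\<ge>0. \<exists>v\<ge>0. \<exists>x. u + v = 1 \<and> x \<in> X \<and> z = u *\<^sub>R a + v *\<^sub>R x)"
    using assms by (simp add: convex_hull_insert hull_same)
  also have "\<dots> \<longleftrightarrow> (\<exists>x\<in>X. \<exists>t. 0 \<le> t \<and> t \<le> 1 \<and> z = (1 - t) *\<^sub>R x + t *\<^sub>R a)" (is "?l = ?r")
  proof
    assume ?l
    then obtain u v x where "u \<ge> 0" "v \<ge> 0" "u + v = 1" "x \<in> X" "z = u *\<^sub>R a + v *\<^sub>R x"
      by blast
    then show ?r
      by (intro bexI[of _ x] exI[of _ u]) (auto simp: add.commute eq_diff_eq)
  next
    assume ?r
    then obtain x t where "x \<in> X" "0 \<le> t" "t \<le> 1" "z = (1 - t) *\<^sub>R x + t *\<^sub>R a"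
      by blast
    then show ?l
      by (intro exI[of _ t] exI[of _ "1 - t"] exI[of _ x] conjI) (auto simp: algebra_simps)
  qed
  finally show ?thesis .
qed

text \<open>The apex itself is covered by the second alternative, with
  \<open>F' = {}\<close>.\<close>

lemma face_of_pyramid_iff:
  fixes X :: "'a::euclidean_space set"
  assumes "polytope X" "a \<notin> affine hull X"
  shows "F face_of convex hull (insert a X) \<longleftrightarrow>
    F face_of X \<or> (\<exists>F'. F' face_of X \<and> F = convex hull (insert a F'))"
proof -
  obtain S where S: "finite S" "X = convex hull S"
    using assms(1) polytope_def by blast
  have "convex hull (insert a X) = convex hull (insert a S)"
    unfolding S(2) by (metis hull_insert)
  moreover have "a \<notin> affine hull S"
    using assms(2) S(2) by simp
  ultimately show ?thesis
    using face_of_convex_hull_insert_eq[OF S(1), of a F] S(2) by simp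
qed

lemma polytope_pyramid:
  fixes X :: "'a::euclidean_space set"
  assumes "polytope X"
  shows "polytope (convex hull (insert a X))"
proof -
  obtain S where S: "finite S" "X = convex hull S"
    using assms polytope_def by blast
  have "convex hull (insert a X) = convex hull (insert a S)"
    unfolding S(2) by (metis hull_insert)
  then show ?thesis
    using S(1) polytope_def by blast
qed

text \<open>A relative interior point lies on no proper face. Avoiding the base gives
  \<open>t \<noteq> 0\<close>, avoiding the apex gives \<open>t \<noteq> 1\<close>, and avoiding the
  pyramids over proper faces of \<open>X\<close> puts \<open>x\<close> in the relative interior of
  \<open>X\<close>.\<close>

lemma rel_interior_pyramidE:
  fixes X :: "'a::euclidean_space set"
  assumes X: "polytope X" "X \<noteq> {}" and a: "a \<notin> affine hull X"
    and z: "z \<in> rel_interior (convex hull (insert a X))"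
  obtains x t where "x \<in> rel_interior X" "0 < t" "t < 1" "z = (1 - t) *\<^sub>R x + t *\<^sub>R a"
proof -
  let ?Z = "convex hull (insert a X)"
  have conv: "convex X"
    using X(1) polytope_imp_convex by blast
  have noface: "z \<notin> F" if "F face_of ?Z" "F \<noteq> ?Z" for F
    using face_of_disjoint_rel_interior[OF that] z by blast
  have aX: "a \<notin> X"
    using a hull_inc by metis
  have ZX: "a \<in> ?Z" "X \<subseteq> ?Z"
    using hull_subset[of "insert a X" convex] by auto
  have "z \<in> ?Z"
    using z rel_interior_subset by blast
  then obtain x t where x: "x \<in> X" and t: "0 \<le> t" "t \<le> 1" and zeq: "z = (1 - t) *\<^sub>R x + t *\<^sub>R a"
    using in_convex_hull_insert_iff[OF conv X(2)] by blast
  have "z \<notin> X"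
    using noface[of X] face_of_pyramid_iff[OF X(1) a] face_of_refl[OF conv] ZX aX by blast
  then have "t \<noteq> 0"
    using x zeq by auto
  have "{a} face_of ?Z"
    using face_of_pyramid_iff[OF X(1) a, of "{a}"] by (metis convex_hull_singleton empty_face_of)
  moreover have "{a} \<noteq> ?Z"
    using ZX X(2) aX by (metis singletonD subsetD subset_singletonD insertI1)
  ultimately have "z \<noteq> a"
    using noface[of "{a}"] by blast
  then have "t \<noteq> 1"
    using zeq by auto
  have "x \<in> rel_interior X"
  proof (rule ccontr)
    assume "x \<notin> rel_interior X"
    then have "{x} \<inter> rel_interior X = {}"
      by simp
    then obtain F where F: "F face_of X" "F \<noteq> X" "x \<in> F"
      using subset_proper_face[OF X(1), of "{x}"] x by auto
    have FX: "F \<subseteq> X" "convex F" "F \<noteq> {}"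
      using F face_of_imp_subset face_of_imp_convex conv by blast+
    have "convex hull (insert a F) \<noteq> ?Z"
    proof
      assume eq: "convex hull (insert a F) = ?Z"
      have "y \<in> F" if "y \<in> X" for y
      proof -
        have "y \<in> convex hull (insert a F)"
          using ZX(2) that eq by blast
        then obtain w s where w: "w \<in> F" "0 \<le> s" "s \<le> 1" "y = (1 - s) *\<^sub>R w + s *\<^sub>R a"
          using in_convex_hull_insert_iff[OF FX(2,3)] by blast
        \<comment> \<open>For \<open>s \<noteq> 0\<close> the equation can be solved for
          \<open>a\<close>, which then lies on a line through two points of
          \<open>X\<close>.\<close>
        have "s = 0"
        proof (rule ccontr)
          assume "s \<noteq> 0"
          then have "a = (1 - 1/s) *\<^sub>R w + (1/s) *\<^sub>R y"
            using w by (simp add: scaleR_right_distrib scaleR_left_diff_distrib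
                scaleR_right_diff_distrib)
          then have "a \<in> affine hull X"
            using mem_affine[OF affine_affine_hull, of w X y "1 - 1/s" "1/s"] w(1) that FX(1)
            by (metis diff_add_cancel hull_inc subsetD)
          then show False
            using a by blast
        qed
        then show ?thesis
          using w by simp
      qed
      then show False
        using F FX by blast
    qed
    moreover have "convex hull (insert a F) face_of ?Z"
      using face_of_pyramid_iff[OF X(1) a] F(1) by blast
    moreover have "z \<in> convex hull (insert a F)"
      using in_convex_hull_insert_iff[OF FX(2,3)] F(3) t zeq by blast
    ultimately show False
      using noface by blast
  qed
  then show ?thesis
    using that t zeq \<open>t \<noteq> 0\<close> \<open>t \<noteq> 1\<close> by (metis less_eq_real_def)
qed

section \<open>Locally finite families, cellulations and face-to-face complexes\<close>

definition bounded_finite :: "'a::real_normed_vector set set \<Rightarrow> bool" where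
  "bounded_finite D \<longleftrightarrow> (\<forall>r. finite {C \<in> D. C \<inter> cball 0 r \<noteq> {}})"

lemma bounded_finiteD:
  assumes "bounded_finite D" "bounded B"
  shows "finite {C \<in> D. C \<inter> B \<noteq> {}}"
proof -
  obtain r where "B \<subseteq> cball 0 r"
    using bounded_subset_ballD[OF assms(2), of 0] ball_subset_cball by (meson order_trans)
  then have "{C \<in> D. C \<inter> B \<noteq> {}} \<subseteq> {C \<in> D. C \<inter> cball 0 r \<noteq> {}}"
    by blast
  then show ?thesis
    using assms(1) finite_subset unfolding bounded_finite_def by blast
qed

text \<open>A decomposition into polytopes with disjoint relative interiors that need not be
  face-to-face: the relative boundary of a cell is only required to be a union of cells.\<close>

definition cellulation :: "'a::euclidean_space set \<Rightarrow> 'a set set \<Rightarrow> bool" where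
  "cellulation W D \<longleftrightarrow>
     (\<forall>C\<in>D. polytope C \<and> C \<noteq> {}) \<and>
     (\<forall>C\<in>D. \<forall>C'\<in>D. rel_interior C \<inter> rel_interior C' \<noteq> {} \<longrightarrow> C = C') \<and>
     (\<forall>C\<in>D. \<forall>x\<in>C. \<exists>C'\<in>D. x \<in> rel_interior C' \<and> C' \<subseteq> C) \<and>
     bounded_finite D \<and> \<Union>D = W"

text \<open>The form in which completions pass through the induction. The empty set is excluded so
  that every member has a relative interior point; \<open>bounded_finite\<close> gives local
  finiteness because every point has bounded neighbourhoods.\<close>

definition complete_complex :: "'a::euclidean_space set \<Rightarrow> 'a set set \<Rightarrow> bool" where
  "complete_complex W \<Psi> \<longleftrightarrow>
     polytopal_complex W \<Psi> \<and> {} \<notin> \<Psi> \<and> bounded_finite \<Psi> \<and> \<Union>\<Psi> = W"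

text \<open>A relative interior point of \<open>X \<inter> Y\<close> lies in the relative interior
  of a face of \<open>X\<close> and of a face of \<open>Y\<close>. By disjointness these are one and
  the same face, which contains \<open>X \<inter> Y\<close> and is contained in it. So meeting
  face-to-face never has to be checked directly.\<close>

lemma polytopal_complexI:
  fixes \<Psi> :: "'a::euclidean_space set set"
  assumes poly: "\<And>X. X \<in> \<Psi> \<Longrightarrow> polytope X \<and> X \<subseteq> W"
    and face: "\<And>X F. X \<in> \<Psi> \<Longrightarrow> F face_of X \<Longrightarrow> F \<noteq> {} \<Longrightarrow> F \<in> \<Psi>"
    and disj: "\<And>X Y. X \<in> \<Psi> \<Longrightarrow> Y \<in> \<Psi> \<Longrightarrow> rel_interior X \<inter> rel_interior Y \<noteq> {} \<Longrightarrow> X = Y"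
  shows "polytopal_complex W \<Psi>"
proof -
  have "(X \<inter> Y) face_of X \<and> (X \<inter> Y) face_of Y" if XY: "X \<in> \<Psi>" "Y \<in> \<Psi>" "X \<inter> Y \<noteq> {}" for X Y
  proof -
    have "convex (X \<inter> Y)"
      using poly XY by (simp add: convex_Int polytope_imp_convex)
    then obtain x where x: "x \<in> rel_interior (X \<inter> Y)"
      using XY(3) rel_interior_eq_empty by blast
    then have xXY: "x \<in> X" "x \<in> Y"
      using rel_interior_subset by blast+
    obtain F where F: "F face_of X" "x \<in> rel_interior F"
      using exists_face_rel_interior poly XY xXY by blast
    obtain G where G: "G face_of Y" "x \<in> rel_interior G"
      using exists_face_rel_interior poly XY xXY by blast
    have ne: "F \<noteq> {}" "G \<noteq> {}"
      using F G by auto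
    have "F = G"
      using disj[of F G] face[OF XY(1) F(1) ne(1)] face[OF XY(2) G(1) ne(2)] F(2) G(2) by blast
    have "X \<inter> Y \<subseteq> F"
      using subset_of_face_of[OF F(1), of "X \<inter> Y"] F(2) x rel_interior_subset by blast
    moreover have "F \<subseteq> X \<inter> Y"
      using F(1) G(1) \<open>F = G\<close> face_of_imp_subset by blast
    ultimately show ?thesis
      using F(1) G(1) \<open>F = G\<close> by (metis subset_antisym)
  qed
  then show ?thesis
    using poly face unfolding polytopal_complex_def polyhedral_complex_def
    by (auto simp: polytope_imp_polyhedron)
qed

lemma polytopal_complexD:
  assumes "polytopal_complex W \<Psi>" "X \<in> \<Psi>"
  shows "polytope X" "X \<subseteq> W" "convex X"
    and "F face_of X \<Longrightarrow> F \<noteq> {} \<Longrightarrow> F \<in> \<Psi>"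
    and "Y \<in> \<Psi> \<Longrightarrow> (X \<inter> Y) face_of X"
proof -
  show "polytope X" "X \<subseteq> W" "F face_of X \<Longrightarrow> F \<noteq> {} \<Longrightarrow> F \<in> \<Psi>"
    using assms unfolding polytopal_complex_def polyhedral_complex_def by blast+
  then show "convex X"
    using polytope_imp_convex by blast
  show "Y \<in> \<Psi> \<Longrightarrow> (X \<inter> Y) face_of X"
    using assms empty_face_of unfolding polytopal_complex_def polyhedral_complex_def by metis
qed

text \<open>\<open>X \<inter> Y\<close> is a face of \<open>X\<close> that meets its relative
  interior, hence all of \<open>X\<close>.\<close>

lemma polytopal_complex_subset_cell:
  assumes "polytopal_complex W \<Psi>" "X \<in> \<Psi>" "Y \<in> \<Psi>" "rel_interior X \<inter> Y \<noteq> {}"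
  shows "X \<subseteq> Y" "X face_of Y"
proof -
  show "X \<subseteq> Y"
    using subset_of_face_of[OF polytopal_complexD(5)[OF assms(1,2,3)], of X] assms(4)
      rel_interior_subset[of X] by blast
  then show "X face_of Y"
    using polytopal_complexD(5)[OF assms(1,3,2)] by (simp add: Int_absorb1)
qed

lemma complete_complex_cellulation:
  assumes "complete_complex W \<Psi>"
  shows "cellulation W \<Psi>"
proof -
  have C: "polytopal_complex W \<Psi>" "{} \<notin> \<Psi>" "bounded_finite \<Psi>" "\<Union>\<Psi> = W"
    using assms unfolding complete_complex_def by auto
  have 1: "X = Y" if "X \<in> \<Psi>" "Y \<in> \<Psi>" "rel_interior X \<inter> rel_interior Y \<noteq> {}" for X Y
  proof (rule subset_antisym)
    show "X \<subseteq> Y"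
      using polytopal_complex_subset_cell(1)[OF C(1) that(1,2)] that(3) rel_interior_subset[of Y]
      by blast
    show "Y \<subseteq> X"
      using polytopal_complex_subset_cell(1)[OF C(1) that(2,1)] that(3) rel_interior_subset[of X]
      by blast
  qed
  have 2: "\<exists>C'\<in>\<Psi>. x \<in> rel_interior C' \<and> C' \<subseteq> X" if x: "X \<in> \<Psi>" "x \<in> X" for X x
  proof -
    obtain F where F: "F face_of X" "x \<in> rel_interior F"
      using exists_face_rel_interior[OF polytopal_complexD(1)[OF C(1) x(1)] x(2)] by blast
    then have "F \<in> \<Psi>"
      using polytopal_complexD(4)[OF C(1) x(1) F(1)] F(2) by force
    then show ?thesis
      using F face_of_imp_subset by blast
  qed
  have 3: "polytope X \<and> X \<noteq> {}" if "X \<in> \<Psi>" for X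
    using polytopal_complexD(1)[OF C(1) that] C(2) that by auto
  show ?thesis
    unfolding cellulation_def
    by (intro conjI ballI impI) (use 1 2 3 C in simp_all)
qed

lemma complete_complexD:
  assumes "complete_complex W \<Psi>"
  shows "polytopal_complex W \<Psi>" "{} \<notin> \<Psi>" "bounded_finite \<Psi>" "\<Union>\<Psi> = W"
  using assms unfolding complete_complex_def by auto

text \<open>The cellulation is described by the map \<open>d\<close> sending a point to the cell
  that has it in its relative interior, which turns the axioms into pointwise conditions. Both the
  grid and the modified arrangement are given in this form.\<close>

lemma cellulationI:
  fixes d :: "'a::euclidean_space \<Rightarrow> 'a set"
  assumes poly: "\<And>x. x \<in> W \<Longrightarrow> polytope (d x)" and sub: "\<And>x. x \<in> W \<Longrightarrow> d x \<subseteq> W"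
    and self: "\<And>x. x \<in> W \<Longrightarrow> x \<in> rel_interior (d x)"
    and eq: "\<And>x y. x \<in> W \<Longrightarrow> y \<in> rel_interior (d x) \<Longrightarrow> d y = d x"
    and mono: "\<And>x y. x \<in> W \<Longrightarrow> y \<in> d x \<Longrightarrow> d y \<subseteq> d x"
    and fin: "bounded_finite (d ` W)"
  shows "cellulation W (d ` W)"
  unfolding cellulation_def
proof (intro conjI ballI impI)
  show "polytope C" "C \<noteq> {}" if "C \<in> d ` W" for C
    using that poly self by fastforce+
  show "C = C'" if C: "C \<in> d ` W" "C' \<in> d ` W" "rel_interior C \<inter> rel_interior C' \<noteq> {}" for C C'
  proof -
    obtain z where "z \<in> rel_interior C" "z \<in> rel_interior C'"
      using C(3) by blast
    then have "d z = C" "d z = C'"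
      using C(1,2) eq by auto
    then show ?thesis
      by simp
  qed
  show "\<exists>C'\<in>d ` W. x \<in> rel_interior C' \<and> C' \<subseteq> C" if C: "C \<in> d ` W" "x \<in> C" for C x
  proof (intro bexI conjI)
    have "x \<in> W"
      using C sub by auto
    then show "x \<in> rel_interior (d x)" "d x \<in> d ` W"
      using self by auto
    show "d x \<subseteq> C"
      using C mono by auto
  qed
  show "\<Union>(d ` W) = W"
  proof
    show "\<Union>(d ` W) \<subseteq> W"
      using sub by blast
    show "W \<subseteq> \<Union>(d ` W)"
    proof
      fix x assume "x \<in> W"
      then show "x \<in> \<Union>(d ` W)"
        using self[of x] rel_interior_subset[of "d x"] by auto
    qed
  qed
qed (fact fin)

section \<open>Coning off a cellulation\<close>

text \<open>A subdivision in the style of the barycentric one, in which the cells of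
  \<open>K\<close> are kept whole. Since kept cells occur as bases of pyramids, their faces become
  faces of the new cells and must be kept too.\<close>

locale coning =
  fixes W :: "'a::euclidean_space set" and D K :: "'a set set" and c :: "'a set \<Rightarrow> 'a"
  assumes cell: "cellulation W D" and KD: "K \<subseteq> D"
    and Kface: "\<lbrakk>F \<in> K; G face_of F; G \<noteq> {}\<rbrakk> \<Longrightarrow> G \<in> K"
    and apex_in: "\<lbrakk>C \<in> D; C \<notin> K\<rbrakk> \<Longrightarrow> c C \<in> rel_interior C"
begin

text \<open>The second argument is the carrier, the cell of \<open>D\<close> that is being
  subdivided. The base of a pyramid is a piece of a proper subcell, so the order by increasing
  dimension is implicit in the recursion.\<close>

inductive cone_cell :: "'a set \<Rightarrow> 'a set \<Rightarrow> bool" where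
  kept: "C \<in> K \<Longrightarrow> cone_cell C C"
| apex: "C \<in> D \<Longrightarrow> C \<notin> K \<Longrightarrow> cone_cell {c C} C"
| cone: "C \<in> D \<Longrightarrow> C \<notin> K \<Longrightarrow> cone_cell X C' \<Longrightarrow> C' \<subseteq> C \<Longrightarrow> C' \<noteq> C \<Longrightarrow>
    cone_cell (convex hull (insert (c C) X)) C"

lemma cellD:
  assumes "C \<in> D"
  shows "polytope C" "convex C" "C \<noteq> {}" "C \<subseteq> W"
    and "C' \<in> D \<Longrightarrow> rel_interior C \<inter> rel_interior C' \<noteq> {} \<Longrightarrow> C = C'"
    and "x \<in> C \<Longrightarrow> \<exists>C'\<in>D. x \<in> rel_interior C' \<and> C' \<subseteq> C"
proof -
  show "polytope C" "C \<noteq> {}" "C \<subseteq> W"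
    using cell assms unfolding cellulation_def by auto
  then show "convex C"
    by (simp add: polytope_imp_convex)
  show "C' \<in> D \<Longrightarrow> rel_interior C \<inter> rel_interior C' \<noteq> {} \<Longrightarrow> C = C'"
    using cell assms unfolding cellulation_def by simp
  show "x \<in> C \<Longrightarrow> \<exists>C'\<in>D. x \<in> rel_interior C' \<and> C' \<subseteq> C"
    using cell assms unfolding cellulation_def by simp
qed

text \<open>A common point would lie in the relative interior of some cell inside \<open>C'\<close>;
  by disjointness of relative interiors that cell is \<open>C\<close>, contradicting that
  \<open>C'\<close> is a proper subcell.\<close>

lemma proper_disjoint:
  assumes "C \<in> D" "C' \<in> D" "C' \<subseteq> C" "C' \<noteq> C"
  shows "C' \<inter> rel_interior C = {}"
proof (rule ccontr)
  assume "C' \<inter> rel_interior C \<noteq> {}"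
  then obtain y where y: "y \<in> C'" "y \<in> rel_interior C"
    by blast
  then obtain C'' where "C'' \<in> D" "y \<in> rel_interior C''" "C'' \<subseteq> C'"
    using cellD(6)[OF assms(2)] by blast
  then show False
    using cellD(5)[OF assms(1)] assms(3,4) y(2) by blast
qed

text \<open>A proper subcell lies in a proper face, so dimension can serve as the measure for
  recursion over cells.\<close>

lemma proper_aff_dim:
  assumes "C \<in> D" "C' \<in> D" "C' \<subseteq> C" "C' \<noteq> C"
  shows "nat (aff_dim C') < nat (aff_dim C)"
proof -
  obtain F where F: "F face_of C" "F \<noteq> C" "C' \<subseteq> F"
    using subset_proper_face[OF cellD(1)[OF assms(1)] cellD(2,3)[OF assms(2)] assms(3)
        proper_disjoint[OF assms]] by blast
  then have "aff_dim C' < aff_dim C"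
    using face_of_aff_dim_lt[OF cellD(2)[OF assms(1)]] aff_dim_subset[of C' F] by fastforce
  moreover have "aff_dim C' \<ge> 0"
    using cellD(3)[OF assms(2)] by (metis aff_dim_negative_iff not_le)
  ultimately show ?thesis
    by linarith
qed

text \<open>The inclusion of relative interiors is the essential part: since open cells of
  \<open>D\<close> are disjoint, it makes the carrier of a piece unique. It holds because a relative
  interior point of a pyramid lies strictly between a boundary point of \<open>C\<close> and the
  apex.\<close>

lemma cone_cell_basic:
  assumes "cone_cell X C"
  shows "C \<in> D \<and> polytope X \<and> X \<noteq> {} \<and> X \<subseteq> C \<and> rel_interior X \<subseteq> rel_interior C"
  using assms
proof (induction rule: cone_cell.induct)
  case (kept C)
  then have "C \<in> D"
    using KD by blast
  then show ?case
    using cellD(1,3) by blast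
next
  case (apex C)
  then show ?case
    using apex_in[OF apex] rel_interior_subset[of C] polytope_convex_hull[of "{c C}"]
    by auto
next
  case (cone C X C')
  have cC: "c C \<in> rel_interior C"
    using cone.hyps(1,2) apex_in by blast
  have XC: "X \<subseteq> C" "X \<inter> rel_interior C = {}"
    using cone.IH cone.hyps(4,5) proper_disjoint[OF cone.hyps(1), of C'] by auto
  have na: "c C \<notin> affine hull X"
    using notin_affine_hull_frontier_subset[OF cellD(1)[OF cone(1)] _ XC cC] cone.IH
      polytope_imp_convex by blast
  have "convex hull (insert (c C) X) \<subseteq> C"
    using cC XC(1) rel_interior_subset[of C] cellD(2)[OF cone(1)] by (intro hull_minimal) auto
  moreover have "rel_interior (convex hull (insert (c C) X)) \<subseteq> rel_interior C"
  proof
    fix z assume z: "z \<in> rel_interior (convex hull (insert (c C) X))"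
    obtain x t where "x \<in> rel_interior X" "0 < t" "t < 1" "z = (1 - t) *\<^sub>R x + t *\<^sub>R c C"
      using rel_interior_pyramidE[OF _ _ na z] cone.IH by metis
    then show "z \<in> rel_interior C"
      using in_rel_interior_segment[OF cellD(2)[OF cone(1)] cC, of x t] XC(1)
        rel_interior_subset[of X] by auto
  qed
  ultimately show ?case
    using cone.hyps(1) cone.IH polytope_pyramid[of X "c C"] by simp
qed

lemma coneD:
  assumes "C \<in> D" "C \<notin> K" "cone_cell X C'" "C' \<subseteq> C" "C' \<noteq> C"
  shows "X \<subseteq> C" "X \<inter> rel_interior C = {}" "c C \<notin> affine hull X" "polytope X" "convex X" "X \<noteq> {}"
proof -
  show XC: "X \<subseteq> C" "X \<inter> rel_interior C = {}" "polytope X" "X \<noteq> {}"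
    using cone_cell_basic[OF assms(3)] proper_disjoint[OF assms(1), of C'] assms(4,5) by auto
  then show "convex X"
    by (simp add: polytope_imp_convex)
  then show "c C \<notin> affine hull X"
    using notin_affine_hull_frontier_subset[OF cellD(1)[OF assms(1)] _ XC(1,2)]
      apex_in[OF assms(1,2)] by simp
qed

text \<open>A face of a pyramid is a face of the base, the apex, or a pyramid over a face of the
  base; in the first and last cases the induction hypothesis applies to the face of the
  base.\<close>

lemma cone_cell_face:
  assumes "cone_cell X C" "F face_of X" "F \<noteq> {}"
  shows "\<exists>C'\<in>D. C' \<subseteq> C \<and> cone_cell F C'"
  using assms
proof (induction arbitrary: F rule: cone_cell.induct)
  case (kept C)
  then have "F \<in> K"
    using Kface by blast
  then show ?case
    using kept KD cone_cell.kept face_of_imp_subset by blast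
next
  case (apex C)
  then show ?case
    using cone_cell.apex face_of_imp_subset by (metis subset_refl subset_singletonD)
next
  case (cone C X C')
  note c = coneD[OF cone.hyps(1,2,3,4,5)]
  consider "F face_of X" | F' where "F' face_of X" "F = convex hull (insert (c C) F')"
    using face_of_pyramid_iff[OF c(4,3)] cone.prems(1) by blast
  then show ?case
  proof cases
    case 1
    then obtain C'' where "C'' \<in> D" "C'' \<subseteq> C'" "cone_cell F C''"
      using cone.IH[OF 1 cone.prems(2)] by blast
    then show ?thesis
      using cone.hyps(4) by (intro bexI[of _ C'']) auto
  next
    case 2
    show ?thesis
    proof (cases "F' = {}")
      case True
      then show ?thesis
        using 2(2) cone_cell.apex[OF cone.hyps(1,2)] cone.hyps(1) by (intro bexI[of _ C]) auto
    next
      case False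
      then obtain C'' where "C'' \<in> D" "C'' \<subseteq> C'" "cone_cell F' C''"
        using cone.IH[OF 2(1) False] by blast
      moreover from this have "C'' \<subseteq> C" "C'' \<noteq> C"
        using cone.hyps(4,5) by blast+
      ultimately show ?thesis
        using 2(2) cone_cell.cone[OF cone.hyps(1,2), of F' C''] cone.hyps(1) by (intro bexI[of _ C]) auto
    qed
  qed
qed

text \<open>Radial projection from a relative interior point to the relative boundary is well
  defined.\<close>

lemma ray_unique:
  fixes C :: "'a set"
  assumes "convex C" "c0 \<in> rel_interior C" "x \<in> C" "x \<notin> rel_interior C"
    "y \<in> C" "y \<notin> rel_interior C" "s < 1" "t < 1"
    and eq: "(1 - s) *\<^sub>R x + s *\<^sub>R c0 = (1 - t) *\<^sub>R y + t *\<^sub>R c0"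
  shows "x = y"
proof -
  have *: "x = y" if "s \<le> t" "s < 1" "t < 1" "x \<in> C" "x \<notin> rel_interior C"
     "y \<in> C" "y \<notin> rel_interior C"
     "(1 - s) *\<^sub>R x + s *\<^sub>R c0 = (1 - t) *\<^sub>R y + t *\<^sub>R c0" for x y s t
  proof -
    \<comment> \<open>Solving the equation for \<open>x\<close> places it on the segment from
      \<open>y\<close> to \<open>c0\<close> with parameter \<open>?r\<close>. A positive
      \<open>?r\<close> would move \<open>x\<close> into the relative interior.\<close>
    let ?r = "(t - s) / (1 - s)"
    have "(1 - s) * (1 - ?r) = 1 - t" "(1 - s) * ?r = t - s"
      using that(2) by (auto simp: field_simps)
    then have "(1 - s) *\<^sub>R ((1 - ?r) *\<^sub>R y + ?r *\<^sub>R c0) = (1 - t) *\<^sub>R y + (t - s) *\<^sub>R c0"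
      by (simp only: scaleR_right_distrib scaleR_scaleR)
    also have "\<dots> = (1 - s) *\<^sub>R x"
      using that(8) by (simp add: algebra_simps)
    finally have x: "x = (1 - ?r) *\<^sub>R y + ?r *\<^sub>R c0"
      using that(2) by (metis diff_gt_0_iff_gt less_irrefl scaleR_left_imp_eq)
    have "?r = 0"
    proof (rule ccontr)
      assume "?r \<noteq> 0"
      then have "0 < ?r" "?r \<le> 1"
        using that(1-3) by auto
      then show False
        using in_rel_interior_segment[OF assms(1,2) that(6), of ?r] x that(5) by simp
    qed
    then show ?thesis
      using x by (simp only: diff_zero scaleR_one scaleR_zero_left add_0_right)
  qed
  show ?thesis
    using *[of s t x y] *[of t s y x] assms by (metis linear)
qed

text \<open>Pieces whose relative interiors meet have the same carrier. Inside one carrier,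
  projecting the common point from the apex gives a common relative interior point of the two bases,
  and the induction hypothesis identifies the bases.\<close>

lemma cone_cell_disjoint:
  assumes "cone_cell X C" "cone_cell Y C'" "rel_interior X \<inter> rel_interior Y \<noteq> {}"
  shows "X = Y"
  using assms
proof (induction arbitrary: Y C' rule: cone_cell.induct)
  case (kept C)
  have "C \<in> D" "rel_interior Y \<subseteq> rel_interior C'" "C' \<in> D"
    using kept KD cone_cell_basic[OF kept(2)] by auto
  then have "C = C'"
    using cellD(5)[of C C'] kept by blast
  then show ?case
    using kept(2) kept(1) by (auto elim: cone_cell.cases)
next
  case (apex C)
  have Y: "rel_interior Y \<subseteq> rel_interior C'" "C' \<in> D"
    using cone_cell_basic[OF apex(3)] by auto
  have cC: "c C \<in> rel_interior C" "c C \<in> rel_interior Y"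
    using apex apex_in by auto
  then have "C = C'"
    using cellD(5)[of C C'] Y apex by blast
  from apex(3) show ?case
  proof cases
    case (cone X C'')
    note c = coneD[OF cone(2-6)]
    have "c C \<in> rel_interior (convex hull insert (c C) X)"
      using cone cC \<open>C = C'\<close> by simp
    then obtain x t where "x \<in> rel_interior X" "0 < t" "t < 1" "c C = (1 - t) *\<^sub>R x + t *\<^sub>R c C"
      using rel_interior_pyramidE[OF c(4,6,3)] \<open>C = C'\<close> by metis
    then have "(1 - t) *\<^sub>R c C = (1 - t) *\<^sub>R x"
      by (simp add: algebra_simps)
    then have "x = c C"
      using \<open>t < 1\<close> by simp
    then show ?thesis
      using c(2) cC \<open>C = C'\<close> \<open>x \<in> rel_interior X\<close> rel_interior_subset[of X] by blast
  qed (use apex \<open>C = C'\<close> in auto)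
next
  case (cone C X C1)
  note c = coneD[OF cone.hyps(1,2,3,4,5)]
  let ?Z = "convex hull (insert (c C) X)"
  have Z: "rel_interior ?Z \<subseteq> rel_interior C"
    using cone_cell_basic[OF cone_cell.cone[OF cone.hyps(1,2,3,4,5)]] by blast
  have Y: "rel_interior Y \<subseteq> rel_interior C'" "C' \<in> D"
    using cone_cell_basic[OF cone.prems(1)] by auto
  have CC: "C = C'"
    using cellD(5)[of C C'] Y Z cone.hyps cone.prems by blast
  have cC: "c C \<in> rel_interior C"
    using apex_in cone.hyps by blast
  obtain z where z: "z \<in> rel_interior ?Z" "z \<in> rel_interior Y"
    using cone.prems by blast
  obtain x s where x: "x \<in> rel_interior X" "0 < s" "s < 1" "z = (1 - s) *\<^sub>R x + s *\<^sub>R c C"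
    using rel_interior_pyramidE[OF c(4,6,3) z(1)] by metis
  have xC: "x \<in> C" "x \<notin> rel_interior C"
    using x(1) c(1,2) rel_interior_subset[of X] by blast+
  from cone.prems(1) show ?case
  proof cases
    case apex
    then have "z = c C"
      using z CC by simp
    then have "(1 - s) *\<^sub>R c C = (1 - s) *\<^sub>R x"
      using x by (simp add: algebra_simps)
    then have "x = c C"
      using \<open>s < 1\<close> by simp
    then show ?thesis
      using xC cC by blast
  next
    case (cone X' C2)
    note c' = coneD[OF cone(2-6)]
    have "z \<in> rel_interior (convex hull insert (c C') X')"
      using cone z by simp
    then obtain y t where y: "y \<in> rel_interior X'" "0 < t" "t < 1" "z = (1 - t) *\<^sub>R y + t *\<^sub>R c C"
      using rel_interior_pyramidE[OF c'(4,6,3)] CC by metis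
    have yC: "y \<in> C" "y \<notin> rel_interior C"
      using y(1) c'(1,2) rel_interior_subset[of X'] CC by blast+
    have "x = y"
      using ray_unique[OF cellD(2)[OF cone.hyps(1)] cC xC yC x(3) y(3)] x(4) y(4) by simp
    then have "X = X'"
      using cone.IH[OF cone(4)] x(1) y(1) by blast
    then show ?thesis
      using cone(1) CC by simp
  qed (use cone.hyps CC in auto)
qed

text \<open>A point other than the apex is projected from the apex to the relative boundary. The
  image lies in a proper subcell, hence by induction in a piece, and the pyramid over that piece
  contains the point.\<close>

lemma cone_cell_cover:
  assumes "C \<in> D" "z \<in> C"
  shows "\<exists>X C'. cone_cell X C' \<and> C' \<subseteq> C \<and> z \<in> X"
  using assms
proof (induction C arbitrary: z rule: measure_induct_rule[where f = "\<lambda>C. nat (aff_dim C)"])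
  case (less C)
  show ?case
  proof (cases "C \<in> K")
    case True
    then show ?thesis
      using cone_cell.kept less.prems by blast
  next
    case False
    have cC: "c C \<in> rel_interior C"
      using apex_in less.prems False by blast
    show ?thesis
    proof (cases "z = c C")
      case True
      then show ?thesis
        using cone_cell.apex[OF less.prems(1) False] by blast
    next
      case zc: False
      obtain d where d: "0 < d" "c C + d *\<^sub>R (z - c C) \<in> rel_frontier C"
        "\<And>e. 0 \<le> e \<Longrightarrow> e < d \<Longrightarrow> c C + e *\<^sub>R (z - c C) \<in> rel_interior C"
      proof (rule ray_to_rel_frontier[of C "c C" "z - c C"])
        show "bounded C"
          using cellD(1)[OF less.prems(1)] polytope_imp_bounded by blast
        show "c C + (z - c C) \<in> affine hull C"
          using less.prems hull_inc by simp
      qed (use zc cC in auto)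
      define x where "x = c C + d *\<^sub>R (z - c C)"
      have clC: "closed C"
        using cellD(1)[OF less.prems(1)] polytope_imp_closed by blast
      have xC: "x \<in> C" "x \<notin> rel_interior C"
        using d(2) clC unfolding x_def rel_frontier_def by auto
      \<comment> \<open>The exit point \<open>x\<close> lies at or beyond \<open>z\<close>:
        otherwise it would be strictly between \<open>z\<close> and the apex, hence in the relative
        interior.\<close>
      have "d \<ge> 1"
      proof (rule ccontr)
        assume "\<not> d \<ge> 1"
        moreover have "x = (1 - (1 - d)) *\<^sub>R z + (1 - d) *\<^sub>R c C"
          by (simp add: x_def algebra_simps)
        ultimately show False
          using in_rel_interior_segment[OF cellD(2)[OF less.prems(1)] cC less.prems(2), of "1 - d"]
            d(1) xC(2) by simp
      qed
      obtain C1 where C1: "C1 \<in> D" "x \<in> rel_interior C1" "C1 \<subseteq> C"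
        using cellD(6)[OF less.prems(1) xC(1)] by blast
      have "C1 \<noteq> C"
        using C1 xC by blast
      then obtain X C2 where X: "cone_cell X C2" "C2 \<subseteq> C1" "x \<in> X"
        using less.IH[OF proper_aff_dim[OF less.prems(1) C1(1,3)] C1(1), of x] C1(2)
          rel_interior_subset[of C1] by blast
      have C2: "C2 \<subseteq> C" "C2 \<noteq> C"
        using X(2) C1(3) \<open>C1 \<noteq> C\<close> by blast+
      note c = coneD[OF less.prems(1) False X(1) C2]
      have "z = (1 - (1 - 1/d)) *\<^sub>R x + (1 - 1/d) *\<^sub>R c C"
        using d(1) by (simp add: x_def scaleR_right_distrib scaleR_left_diff_distrib)
      moreover have "0 \<le> 1 - 1/d" "1 - 1/d \<le> 1"
        using \<open>d \<ge> 1\<close> by auto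
      ultimately have "z \<in> convex hull (insert (c C) X)"
        using in_convex_hull_insert_iff[OF c(5,6), of z "c C"] X(3) by blast
      then show ?thesis
        using cone_cell.cone[OF less.prems(1) False X(1) C2] by blast
    qed
  qed
qed

lemma finite_subcells:
  assumes "C \<in> D"
  shows "finite {C' \<in> D. C' \<subseteq> C}"
proof -
  have "C' \<inter> C \<noteq> {}" if "C' \<in> D" "C' \<subseteq> C" for C'
    using cellD(3)[OF that(1)] that(2) by (simp add: Int_absorb2)
  then have "{C' \<in> D. C' \<subseteq> C} \<subseteq> {C' \<in> D. C' \<inter> C \<noteq> {}}"
    by auto
  moreover have "finite {C' \<in> D. C' \<inter> C \<noteq> {}}"
  proof (rule bounded_finiteD)
    show "bounded_finite D"
      using cell unfolding cellulation_def by simp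
    show "bounded C"
      using cellD(1)[OF assms] by (rule polytope_imp_bounded)
  qed
  ultimately show ?thesis
    by (rule finite_subset)
qed

text \<open>Apart from \<open>C\<close> and the apex, every piece is a pyramid over a piece of one
  of the finitely many proper subcells.\<close>

lemma finite_cone_cells:
  assumes "C \<in> D"
  shows "finite {X. cone_cell X C}"
  using assms
proof (induction C rule: measure_induct_rule[where f = "\<lambda>C. nat (aff_dim C)"])
  case (less C)
  let ?S = "{C' \<in> D. C' \<subseteq> C \<and> C' \<noteq> C}"
  have "finite ?S"
    using finite_subcells[OF less.prems] by (rule rev_finite_subset) blast
  moreover have "finite {X. cone_cell X C'}" if "C' \<in> ?S" for C'
    using less.IH[OF proper_aff_dim[OF less.prems, of C']] that by simp
  ultimately have "finite (\<Union>C'\<in>?S. {X. cone_cell X C'})"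
    by blast
  then have "finite ({C, {c C}} \<union> (\<lambda>X. convex hull (insert (c C) X)) ` (\<Union>C'\<in>?S. {X. cone_cell X C'}))"
    by blast
  moreover have "{X. cone_cell X C} \<subseteq>
      {C, {c C}} \<union> (\<lambda>X. convex hull (insert (c C) X)) ` (\<Union>C'\<in>?S. {X. cone_cell X C'})"
  proof
    fix X assume "X \<in> {X. cone_cell X C}"
    then have "cone_cell X C"
      by simp
    then show "X \<in> {C, {c C}} \<union> (\<lambda>X. convex hull (insert (c C) X)) ` (\<Union>C'\<in>?S. {X. cone_cell X C'})"
    proof cases
      case (cone X' C')
      then have "C' \<in> ?S"
        using cone_cell_basic by blast
      then show ?thesis
        using cone by blast
    qed auto
  qed
  ultimately show ?case
    by (rule rev_finite_subset)
qed

definition cells :: "'a set set" where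
  "cells = {X. \<exists>C. cone_cell X C}"

lemma cellsE:
  assumes "X \<in> cells"
  obtains C where "cone_cell X C" "C \<in> D" "polytope X" "X \<noteq> {}" "X \<subseteq> C"
  using assms cone_cell_basic unfolding cells_def by auto

lemma bounded_finite_cells: "bounded_finite cells"
  unfolding bounded_finite_def
proof
  fix r :: real
  let ?S = "{C \<in> D. C \<inter> cball 0 r \<noteq> {}}"
  have "finite ?S"
    using cell unfolding cellulation_def bounded_finite_def by simp
  then have "finite (\<Union>C\<in>?S. {X. cone_cell X C})"
    using finite_cone_cells by simp
  moreover have "X \<in> (\<Union>C\<in>?S. {X. cone_cell X C})" if "X \<in> cells" and r: "X \<inter> cball 0 r \<noteq> {}" for X
    using \<open>X \<in> cells\<close>
  proof (rule cellsE)
    fix C assume "cone_cell X C" "C \<in> D" "X \<subseteq> C"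
    moreover from \<open>X \<subseteq> C\<close> r have "C \<inter> cball 0 r \<noteq> {}"
      by blast
    ultimately show ?thesis
      by (intro UN_I[of C]) simp_all
  qed
  ultimately show "finite {X \<in> cells. X \<inter> cball 0 r \<noteq> {}}"
    by (elim rev_finite_subset) auto
qed

lemma complete_complex_cells: "complete_complex W cells"
proof -
  have "polytopal_complex W cells"
  proof (rule polytopal_complexI)
    show "polytope X \<and> X \<subseteq> W" if "X \<in> cells" for X
      using cellsE[OF that] cellD(4) by (metis subset_trans)
    show "F \<in> cells" if "X \<in> cells" "F face_of X" "F \<noteq> {}" for X F
      using cone_cell_face[OF _ that(2,3)] that(1) unfolding cells_def by auto
    show "X = Y" if "X \<in> cells" "Y \<in> cells" "rel_interior X \<inter> rel_interior Y \<noteq> {}" for X Y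
      using cone_cell_disjoint[OF _ _ that(3)] that(1,2) unfolding cells_def by auto
  qed
  moreover have "{} \<notin> cells"
    by (auto elim: cellsE)
  moreover have "\<Union>cells = W"
  proof
    show "\<Union>cells \<subseteq> W"
      using polytopal_complexD(2)[OF calculation(1)] by blast
    show "W \<subseteq> \<Union>cells"
    proof
      fix z assume "z \<in> W"
      then obtain C where "C \<in> D" "z \<in> C"
        using cell unfolding cellulation_def by auto
      then show "z \<in> \<Union>cells"
        using cone_cell_cover[of C z] unfolding cells_def by auto
    qed
  qed
  ultimately show ?thesis
    using bounded_finite_cells unfolding complete_complex_def by simp
qed

lemma kept_cells: "K \<subseteq> cells"
  using cone_cell.kept unfolding cells_def by blast

text \<open>If \<open>S\<close> misses the relative interior of a carrier, coning adds no points of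
  \<open>S\<close>. If \<open>S\<close> is radially invariant from the apex, the pyramid meets
  \<open>S\<close> in the pyramid over the face \<open>X \<inter> S\<close> of its base. The lemma
  is applied to a polytope and to the union of a subcomplex, which may be nonconvex.\<close>

lemma cells_Int_face:
  assumes free: "\<And>C. C \<in> D \<Longrightarrow> C \<notin> K \<Longrightarrow> rel_interior C \<inter> S = {} \<or>
      (c C \<in> S \<and> (\<forall>y\<in>C. \<forall>t. 0 \<le> t \<and> t < 1 \<longrightarrow> ((1 - t) *\<^sub>R y + t *\<^sub>R c C \<in> S \<longleftrightarrow> y \<in> S)))"
    and kept: "\<And>F. F \<in> K \<Longrightarrow> F \<inter> S face_of F"
    and X: "X \<in> cells"
  shows "X \<inter> S face_of X"
proof -
  obtain C where "cone_cell X C"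
    using X unfolding cells_def by blast
  then show ?thesis
  proof (induction rule: cone_cell.induct)
    case (apex C)
    show ?case
      by (cases "c C \<in> S") (simp_all add: face_of_refl)
  next
    case (cone C X C')
    note c = coneD[OF cone.hyps]
    let ?Z = "convex hull (insert (c C) X)"
    note in_Z = in_convex_hull_insert_iff[OF c(5,6), of _ "c C"]
    have cC: "c C \<in> rel_interior C"
      using apex_in cone.hyps by blast
    consider "rel_interior C \<inter> S = {}" |
      "c C \<in> S" "\<And>y t. y \<in> C \<Longrightarrow> 0 \<le> t \<Longrightarrow> t < 1 \<Longrightarrow> (1 - t) *\<^sub>R y + t *\<^sub>R c C \<in> S \<longleftrightarrow> y \<in> S"
      using free[OF cone.hyps(1,2)] by auto
    then show ?case
    proof cases
      case 1
      have "z \<in> X" if "z \<in> ?Z" "z \<in> S" for z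
      proof -
        obtain x t where x: "x \<in> X" "0 \<le> t" "t \<le> 1" "z = (1 - t) *\<^sub>R x + t *\<^sub>R c C"
          using \<open>z \<in> ?Z\<close> unfolding in_Z by blast
        have "t = 0"
          using in_rel_interior_segment[OF cellD(2)[OF cone.hyps(1)] cC, of x t] x c(1) 1 that(2)
          by force
        then show ?thesis
          using x by simp
      qed
      then have "?Z \<inter> S = X \<inter> S"
        using hull_subset[of "insert (c C) X" convex] by auto
      then show ?thesis
        using cone.IH face_of_pyramid_iff[OF c(4,3)] by simp
    next
      case 2
      \<comment> \<open>When the base misses \<open>S\<close>, the right-hand side degenerates to
        the apex.\<close>
      have "?Z \<inter> S = convex hull (insert (c C) (X \<inter> S))"
      proof (cases "X \<inter> S = {}")
        case True
        have "z = c C" if "z \<in> ?Z" "z \<in> S" for z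
        proof -
          obtain x t where x: "x \<in> X" "0 \<le> t" "t \<le> 1" "z = (1 - t) *\<^sub>R x + t *\<^sub>R c C"
            using \<open>z \<in> ?Z\<close> unfolding in_Z by blast
          have "t = 1"
            using 2(2)[of x t] x c(1) True that(2) by fastforce
          then show ?thesis
            using x by simp
        qed
        moreover have "c C \<in> ?Z"
          by (simp add: hull_inc)
        ultimately show ?thesis
          using True 2(1) by auto
      next
        case False
        have "convex (X \<inter> S)"
          using cone.IH face_of_imp_convex c(5) by blast
        note in_ZS = in_convex_hull_insert_iff[OF this False, of _ "c C"]
        show ?thesis
        proof (intro equalityI subsetI)
          fix z assume z: "z \<in> ?Z \<inter> S"
          then obtain x t where x: "x \<in> X" "0 \<le> t" "t \<le> 1" "z = (1 - t) *\<^sub>R x + t *\<^sub>R c C"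
            using IntD1[OF z] unfolding in_Z by blast
          show "z \<in> convex hull (insert (c C) (X \<inter> S))"
          proof (cases "t = 1")
            case True
            then show ?thesis
              using x by (simp add: hull_inc)
          next
            case False
            then have "x \<in> S"
              using 2(2)[of x t] x c(1) z by auto
            then show ?thesis
              using x unfolding in_ZS by blast
          qed
        next
          fix z assume "z \<in> convex hull (insert (c C) (X \<inter> S))"
          then obtain x t where x: "x \<in> X" "x \<in> S" "0 \<le> t" "t \<le> 1" "z = (1 - t) *\<^sub>R x + t *\<^sub>R c C"
            unfolding in_ZS by blast
          have "z \<in> S"
          proof (cases "t = 1")
            case False
            then show ?thesis
              using 2(2)[of x t] x c(1) by auto
          qed (use x 2 in simp)
          then show "z \<in> ?Z \<inter> S"
            using x unfolding Int_iff in_Z by blast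
        qed
      qed
      then show ?thesis
        using face_of_pyramid_iff[OF c(4,3), of "?Z \<inter> S"] cone.IH by blast
    qed
  qed (use kept in auto)
qed

end

section \<open>Cells of hyperplane arrangements\<close>

text \<open>The smallest closed piece containing \<open>x0\<close> among the hyperplane and its two
  closed halfspaces. Degenerate pairs with \<open>a = 0\<close> impose no condition.\<close>

definition side :: "'a::euclidean_space \<Rightarrow> 'a \<times> real \<Rightarrow> 'a set" where
  "side x0 = (\<lambda>(a, b). {x. (a \<bullet> x0 = b \<longrightarrow> a \<bullet> x = b) \<and> (a \<bullet> x0 < b \<longrightarrow> a \<bullet> x \<le> b) \<and>
     (a \<bullet> x0 > b \<longrightarrow> a \<bullet> x \<ge> b)})"

text \<open>The closed and the relatively open cell containing \<open>x0\<close> in the arrangement of the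
  hyperplanes \<open>{x. a \<bullet> x = b}\<close>, \<open>(a, b) \<in> H\<close>.\<close>

definition sign_cell :: "('a::euclidean_space \<times> real) set \<Rightarrow> 'a \<Rightarrow> 'a set" where
  "sign_cell H x0 = (\<Inter>h\<in>H. side x0 h)"

definition open_sign_cell :: "('a::euclidean_space \<times> real) set \<Rightarrow> 'a \<Rightarrow> 'a set" where
  "open_sign_cell H x0 = {x. \<forall>(a, b)\<in>H. sgn (a \<bullet> x - b) = sgn (a \<bullet> x0 - b)}"

lemma side_cases:
  "side x0 (a, b) = (if a \<bullet> x0 = b then {x. a \<bullet> x = b}
     else if a \<bullet> x0 < b then {x. a \<bullet> x \<le> b} else {x. a \<bullet> x \<ge> b})"
  by (auto simp: side_def)

lemma polyhedron_side: "polyhedron (side x0 h)"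
  by (cases h) (simp add: side_cases polyhedron_hyperplane polyhedron_halfspace_le
      polyhedron_halfspace_ge)

lemma rel_interior_side:
  "rel_interior (side x0 (a, b)) = {x. sgn (a \<bullet> x - b) = sgn (a \<bullet> x0 - b)}"
proof (cases "a \<bullet> x0 = b")
  case True
  have "rel_interior {x. a \<bullet> x = b} = {x. a \<bullet> x = b}"
    by (simp add: affine_hyperplane rel_interior_affine)
  then show ?thesis
    using True by (auto simp: side_cases sgn_if)
next
  case False
  show ?thesis
  proof (cases "a = 0")
    case True
    then show ?thesis
      using False by (auto simp: side_cases)
  next
    case a: False
    have "rel_interior {x. a \<bullet> x \<le> b} = {x. a \<bullet> x < b}" "rel_interior {x. a \<bullet> x \<ge> b} = {x. a \<bullet> x > b}"
    proof -
      have "interior {x. a \<bullet> x \<le> b} \<noteq> {}" "interior {x. a \<bullet> x \<ge> b} \<noteq> {}"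
        using a by (simp_all add: halfspace_eq_empty_lt halfspace_eq_empty_gt del: Collect_empty_eq)
      then show "rel_interior {x. a \<bullet> x \<le> b} = {x. a \<bullet> x < b}" "rel_interior {x. a \<bullet> x \<ge> b} = {x. a \<bullet> x > b}"
        using a by (auto simp: rel_interior_nonempty_interior interior_halfspace_le interior_halfspace_ge)
    qed
    then show ?thesis
      using False by (auto simp: side_cases sgn_if)
  qed
qed

lemma polyhedron_sign_cell: "finite H \<Longrightarrow> polyhedron (sign_cell H x0)"
  unfolding sign_cell_def by (intro polyhedron_Inter) (auto simp: polyhedron_side)

text \<open>Relative interiors of convex sets commute with intersection as soon as they have a
  common point; here \<open>x0\<close> is one, so the hyperplanes can be added one at a
  time.\<close>

lemma rel_interior_Int_sign_cell:
  assumes "finite H" "convex C" "x0 \<in> rel_interior C"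
  shows "rel_interior (C \<inter> sign_cell H x0) = rel_interior C \<inter> open_sign_cell H x0"
  using assms(1)
proof (induction H)
  case empty
  then show ?case
    by (simp add: sign_cell_def open_sign_cell_def)
next
  case (insert h H)
  obtain a b where h: "h = (a, b)"
    by (cases h)
  have "sign_cell (insert h H) x0 = sign_cell H x0 \<inter> side x0 h"
    by (auto simp: sign_cell_def)
  then have "C \<inter> sign_cell (insert h H) x0 = (C \<inter> sign_cell H x0) \<inter> side x0 h"
    by blast
  also have "rel_interior \<dots> = rel_interior (C \<inter> sign_cell H x0) \<inter> rel_interior (side x0 h)"
  proof (rule convex_rel_interior_inter_two)
    show "convex (C \<inter> sign_cell H x0)"
      using insert.hyps assms(2) by (simp add: convex_Int polyhedron_imp_convex polyhedron_sign_cell)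
    show "convex (side x0 h)"
      by (simp add: polyhedron_imp_convex polyhedron_side)
    have "x0 \<in> rel_interior (C \<inter> sign_cell H x0)"
      unfolding insert.IH using assms(3) by (simp add: open_sign_cell_def)
    moreover have "x0 \<in> rel_interior (side x0 h)"
      by (simp add: h rel_interior_side)
    ultimately show "rel_interior (C \<inter> sign_cell H x0) \<inter> rel_interior (side x0 h) \<noteq> {}"
      by blast
  qed
  also have "\<dots> = rel_interior C \<inter> open_sign_cell (insert h H) x0"
    unfolding insert.IH by (auto simp: h rel_interior_side open_sign_cell_def)
  finally show ?case .
qed

lemma sign_cell_self: "x \<in> open_sign_cell H x" "x \<in> sign_cell H x"
  by (auto simp: open_sign_cell_def sign_cell_def side_def)

lemma open_sign_cell_subset: "open_sign_cell H x \<subseteq> sign_cell H x"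
proof -
  have "y \<in> side x (a, b)" if "sgn (a \<bullet> y - b) = sgn (a \<bullet> x - b)" for y a b
    using that by (auto simp: side_def sgn_if split: if_splits)
  then show ?thesis
    unfolding open_sign_cell_def sign_cell_def by auto
qed

text \<open>Membership in a closed cell means that the sign vector of \<open>x\<close> arises from
  that of \<open>y\<close> by replacing some entries by zero, and this relation is
  transitive.\<close>

lemma sign_cell_mono:
  assumes "x \<in> sign_cell H y"
  shows "sign_cell H x \<subseteq> sign_cell H y"
proof
  fix z assume z: "z \<in> sign_cell H x"
  have "z \<in> side y h" if "h \<in> H" for h
  proof -
    have "z \<in> side x h" "x \<in> side y h"
      using z assms that unfolding sign_cell_def by blast+
    then show ?thesis
      by (cases h) (auto simp: side_def)
  qed
  then show "z \<in> sign_cell H y"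
    unfolding sign_cell_def by blast
qed

lemma open_sign_cell_eq:
  assumes "x \<in> open_sign_cell H y"
  shows "open_sign_cell H x = open_sign_cell H y" "sign_cell H x = sign_cell H y"
proof -
  have s: "sgn (a \<bullet> x - b) = sgn (a \<bullet> y - b)" if "(a, b) \<in> H" for a b
    using assms that unfolding open_sign_cell_def by blast
  then show eq: "open_sign_cell H x = open_sign_cell H y"
    unfolding open_sign_cell_def by fastforce
  have "y \<in> open_sign_cell H x"
    using eq sign_cell_self by blast
  then show "sign_cell H x = sign_cell H y"
    using sign_cell_mono open_sign_cell_subset assms by (metis subsetD subset_antisym)
qed

text \<open>The order on sign vectors that underlies inclusion of closed cells is
  antisymmetric.\<close>

lemma sign_cell_antisym:
  assumes "y \<in> sign_cell H x" "x \<in> sign_cell H y"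
  shows "y \<in> open_sign_cell H x"
proof -
  have "sgn (a \<bullet> y - b) = sgn (a \<bullet> x - b)" if "(a, b) \<in> H" for a b
  proof -
    have "y \<in> side x (a, b)" "x \<in> side y (a, b)"
      using assms that unfolding sign_cell_def by blast+
    then show ?thesis
      by (auto simp: side_def sgn_if)
  qed
  then show ?thesis
    unfolding open_sign_cell_def by auto
qed

text \<open>A cell is determined by its sign vector, a function from \<open>H\<close> to
  \<open>{-1, 0, 1}\<close>.\<close>

lemma finite_sign_cells:
  assumes "finite H"
  shows "finite (range (sign_cell H))"
proof -
  let ?f = "\<lambda>x. restrict (\<lambda>(a, b). sgn (a \<bullet> x - b)) H"
  have "?f x \<in> H \<rightarrow>\<^sub>E {-1, 0, 1}" for x
  proof (rule PiE_I)
    fix h assume "h \<in> H"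
    then show "?f x h \<in> {-1, 0, 1}"
      by (cases h) (simp add: sgn_real_def)
  qed simp
  then have "range ?f \<subseteq> H \<rightarrow>\<^sub>E {-1, 0, 1}"
    by blast
  then have "finite (range ?f)"
    by (rule finite_subset) (simp add: assms finite_PiE)
  moreover have "sign_cell H x = sign_cell H y" if "?f x = ?f y" for x y
  proof -
    have "?f x h = ?f y h" for h
      using that by simp
    then have "x \<in> open_sign_cell H y"
      unfolding open_sign_cell_def by (force simp: restrict_def split: if_splits)
    then show ?thesis
      by (rule open_sign_cell_eq)
  qed
  then have "sign_cell H x = sign_cell H (SOME y. ?f y = ?f x)" for x
    by (metis (mono_tags, lifting) someI)
  then have "range (sign_cell H) \<subseteq> (\<lambda>g. sign_cell H (SOME y. ?f y = g)) ` range ?f"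
    by blast
  ultimately show ?thesis
    by (meson finite_imageI finite_subset)
qed

text \<open>The cells are the intersections of \<open>W\<close> with the faces of the integer unit
  cubes. The whole grid is an infinite arrangement, but around a given point it is described by the
  finitely many hyperplanes in \<open>H x0\<close>, so the facts on finite arrangements give the
  relative interiors.\<close>

lemma cellulation_grid:
  fixes W :: "'a::euclidean_space set"
  assumes W: "subspace W"
  shows "\<exists>D. cellulation W D"
proof -
  \<comment> \<open>At an integral coordinate of \<open>x0\<close>, floor and ceiling agree and the
    coordinate is fixed.\<close>
  define G where "G x0 = W \<inter> {x. \<forall>i\<in>Basis. \<lfloor>x0 \<bullet> i\<rfloor> \<le> x \<bullet> i \<and> x \<bullet> i \<le> \<lceil>x0 \<bullet> i\<rceil>}" for x0
  define H where "H x0 = (\<lambda>i. (i, real_of_int \<lfloor>x0 \<bullet> i\<rfloor>)) ` Basis \<union> (\<lambda>i. (i, real_of_int \<lceil>x0 \<bullet> i\<rceil>)) ` Basis" for x0 :: 'a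
  have finH: "finite (H x0)" for x0
    unfolding H_def by simp
  have conv: "convex W" "rel_interior W = W" "polyhedron W"
    using W by (auto simp: subspace_imp_affine affine_imp_convex rel_interior_affine affine_imp_polyhedron)
  have nonint: "\<lfloor>r\<rfloor> < r \<and> r < \<lceil>r\<rceil>" if "r \<noteq> \<lfloor>r\<rfloor>" for r :: real
  proof -
    have "r \<noteq> \<lceil>r\<rceil>"
      using that by (metis floor_of_int)
    then show ?thesis
      using that by linarith
  qed
  have GH: "G x0 = W \<inter> sign_cell (H x0) x0" for x0
  proof -
    have "x \<in> side x0 (i, real_of_int \<lfloor>x0 \<bullet> i\<rfloor>) \<and> x \<in> side x0 (i, real_of_int \<lceil>x0 \<bullet> i\<rceil>) \<longleftrightarrow>
        \<lfloor>x0 \<bullet> i\<rfloor> \<le> x \<bullet> i \<and> x \<bullet> i \<le> \<lceil>x0 \<bullet> i\<rceil>" for x i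
    proof (cases "x0 \<bullet> i = \<lfloor>x0 \<bullet> i\<rfloor>")
      case True
      then have "\<lceil>x0 \<bullet> i\<rceil> = \<lfloor>x0 \<bullet> i\<rfloor>"
        by (metis ceiling_of_int)
      then show ?thesis
        using True by (auto simp: side_cases inner_commute)
    next
      case False
      then have "\<lfloor>x0 \<bullet> i\<rfloor> < x0 \<bullet> i" "x0 \<bullet> i < \<lceil>x0 \<bullet> i\<rceil>"
        using nonint by auto
      then show ?thesis
        by (auto simp: side_def inner_commute)
    qed
    moreover have "x \<in> sign_cell (H x0) x0 \<longleftrightarrow>
        (\<forall>i\<in>Basis. x \<in> side x0 (i, real_of_int \<lfloor>x0 \<bullet> i\<rfloor>) \<and> x \<in> side x0 (i, real_of_int \<lceil>x0 \<bullet> i\<rceil>))" for x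
      unfolding H_def sign_cell_def by blast
    ultimately show ?thesis
      unfolding G_def by auto
  qed
  have relG: "rel_interior (G x0) = W \<inter> open_sign_cell (H x0) x0" if "x0 \<in> W" for x0
    unfolding GH using rel_interior_Int_sign_cell[OF finH conv(1), of x0] that conv(2) by simp
  have floor_eq: "\<lfloor>x \<bullet> i\<rfloor> = \<lfloor>x0 \<bullet> i\<rfloor> \<and> \<lceil>x \<bullet> i\<rceil> = \<lceil>x0 \<bullet> i\<rceil>"
    if x: "x \<in> open_sign_cell (H x0) x0" and i: "i \<in> Basis" for x x0 i
  proof -
    have "sgn (i \<bullet> x - \<lfloor>x0 \<bullet> i\<rfloor>) = sgn (i \<bullet> x0 - \<lfloor>x0 \<bullet> i\<rfloor>)"
      "sgn (i \<bullet> x - \<lceil>x0 \<bullet> i\<rceil>) = sgn (i \<bullet> x0 - \<lceil>x0 \<bullet> i\<rceil>)"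
      using x i unfolding open_sign_cell_def H_def by auto
    then have s: "sgn (x \<bullet> i - \<lfloor>x0 \<bullet> i\<rfloor>) = sgn (x0 \<bullet> i - \<lfloor>x0 \<bullet> i\<rfloor>)"
      "sgn (x \<bullet> i - \<lceil>x0 \<bullet> i\<rceil>) = sgn (x0 \<bullet> i - \<lceil>x0 \<bullet> i\<rceil>)"
      by (simp_all add: inner_commute)
    show ?thesis
    proof (cases "x0 \<bullet> i = \<lfloor>x0 \<bullet> i\<rfloor>")
      case True
      then have "x \<bullet> i = \<lfloor>x0 \<bullet> i\<rfloor>"
        using s(1) by (auto simp: sgn_if split: if_splits)
      then show ?thesis
        using True by metis
    next
      case False
      then have l: "\<lfloor>x0 \<bullet> i\<rfloor> < x0 \<bullet> i" "x0 \<bullet> i < \<lceil>x0 \<bullet> i\<rceil>"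
        using nonint by auto
      then have "\<lfloor>x0 \<bullet> i\<rfloor> < x \<bullet> i" "x \<bullet> i < \<lceil>x0 \<bullet> i\<rceil>"
        using s by (auto simp: sgn_if split: if_splits)
      moreover have c: "\<lceil>x0 \<bullet> i\<rceil> = \<lfloor>x0 \<bullet> i\<rfloor> + 1"
        using False by (simp add: ceiling_altdef)
      ultimately show ?thesis
        unfolding c by (auto simp: floor_eq_iff ceiling_eq_iff)
    qed
  qed
  have eqI: "G x = G y" if "\<And>i. i \<in> Basis \<Longrightarrow> \<lfloor>x \<bullet> i\<rfloor> = \<lfloor>y \<bullet> i\<rfloor> \<and> \<lceil>x \<bullet> i\<rceil> = \<lceil>y \<bullet> i\<rceil>" for x y
    using that unfolding G_def by auto
  have self: "x \<in> rel_interior (G x)" if "x \<in> W" for x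
    using relG[OF that] that sign_cell_self by blast
  have box: "G x \<subseteq> cbox (\<Sum>i\<in>Basis. \<lfloor>x \<bullet> i\<rfloor> *\<^sub>R i) (\<Sum>i\<in>Basis. \<lceil>x \<bullet> i\<rceil> *\<^sub>R i)" for x
    unfolding G_def by (auto simp: mem_box)
  have poly: "polytope (G x)" for x
    unfolding polytope_eq_bounded_polyhedron
    using bounded_subset[OF bounded_cbox box] conv(3) polyhedron_sign_cell[OF finH] GH
    by (metis polyhedron_Int)
  have mono: "G x \<subseteq> G y" if "x \<in> G y" for x y
  proof -
    have "\<lfloor>y \<bullet> i\<rfloor> \<le> \<lfloor>x \<bullet> i\<rfloor>" "\<lceil>x \<bullet> i\<rceil> \<le> \<lceil>y \<bullet> i\<rceil>" if "i \<in> Basis" for i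
      using \<open>x \<in> G y\<close> that unfolding G_def by (auto simp: le_floor_iff ceiling_le_iff)
    then show ?thesis
      unfolding G_def by (force intro: order_trans)
  qed
  have bf: "bounded_finite (G ` W)"
    unfolding bounded_finite_def
  proof
    fix r :: real
    \<comment> \<open>The slack allows for a cell that meets the ball but sticks out of it; in each
      coordinate its bounds differ by at most one.\<close>
    define I where "I = {-\<lceil>r\<rceil>-2..\<lceil>r\<rceil>+2}"
    let ?F = "\<lambda>f. W \<inter> {x. \<forall>i\<in>Basis. real_of_int (fst (f i)) \<le> x \<bullet> i \<and> x \<bullet> i \<le> real_of_int (snd (f i))}"
    have "finite (?F ` ((Basis::'a set) \<rightarrow>\<^sub>E I \<times> I))"
      unfolding I_def by (intro finite_imageI finite_PiE) auto
    moreover have "{C \<in> G ` W. C \<inter> cball 0 r \<noteq> {}} \<subseteq> ?F ` ((Basis::'a set) \<rightarrow>\<^sub>E I \<times> I)"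
    proof
      fix C assume "C \<in> {C \<in> G ` W. C \<inter> cball 0 r \<noteq> {}}"
      then obtain y where y: "C = G y" and "G y \<inter> cball 0 r \<noteq> {}"
        by blast
      then obtain z where z: "z \<in> G y" "norm z \<le> r"
        by auto
      let ?f = "\<lambda>i\<in>Basis. (\<lfloor>y \<bullet> i\<rfloor>, \<lceil>y \<bullet> i\<rceil>)"
      have "\<lfloor>y \<bullet> i\<rfloor> \<in> I \<and> \<lceil>y \<bullet> i\<rceil> \<in> I" if i: "i \<in> Basis" for i
      proof -
        have "\<bar>z \<bullet> i\<bar> \<le> r"
          using Basis_le_norm[OF i, of z] z(2) by linarith
        moreover have "\<lfloor>y \<bullet> i\<rfloor> \<le> z \<bullet> i" "z \<bullet> i \<le> \<lceil>y \<bullet> i\<rceil>"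
          using z(1) i unfolding G_def by auto
        moreover have "\<lceil>y \<bullet> i\<rceil> \<le> \<lfloor>y \<bullet> i\<rfloor> + 1"
          by linarith
        ultimately show ?thesis
          unfolding I_def by (auto; linarith)
      qed
      then have "?f \<in> Basis \<rightarrow>\<^sub>E I \<times> I"
        by auto
      moreover have "C = ?F ?f"
        unfolding y G_def by auto
      ultimately show "C \<in> ?F ` (Basis \<rightarrow>\<^sub>E I \<times> I)"
        by (intro image_eqI)
    qed
    ultimately show "finite {C \<in> G ` W. C \<inter> cball 0 r \<noteq> {}}"
      by (rule rev_finite_subset)
  qed
  have "cellulation W (G ` W)"
  proof (rule cellulationI[OF poly _ self _ mono bf])
    show "G x \<subseteq> W" for x
      unfolding G_def by blast
    show "G y = G x" if "x \<in> W" "y \<in> rel_interior (G x)" for x y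
      using relG[OF that(1)] floor_eq[of y x] that(2) by (intro eqI) auto
  qed
  then show ?thesis
    by blast
qed

text \<open>The separating hyperplane is required not to contain \<open>P\<close>.  If the polytopes share a
  point \<open>x0\<close>, one separates \<open>p - x0\<close> from the finitely generated, hence closed, cone spanned by
  \<open>C - x0\<close> and \<open>x0 - P\<close>.\<close>

lemma separate_rel_interior_polytope:
  fixes P C :: "'a::euclidean_space set"
  assumes P: "polytope P" and C: "polytope C" and p: "p \<in> rel_interior P"
    and disj: "C \<inter> rel_interior P = {}"
  shows "\<exists>a b. (\<forall>y\<in>P. b \<le> a \<bullet> y) \<and> (\<forall>y\<in>C. a \<bullet> y \<le> b) \<and> b < a \<bullet> p"
proof (cases "C \<inter> P = {}")
  case True
  have "p \<in> P"
    using p rel_interior_subset by blast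
  obtain a b where "\<forall>x\<in>C. a \<bullet> x < b" "\<forall>x\<in>P. b < a \<bullet> x"
    using separating_hyperplane_closed_compact[of C P] P C True \<open>p \<in> P\<close>
      polytope_imp_convex polytope_imp_closed polytope_imp_compact by (metis empty_iff)
  then show ?thesis
    using \<open>p \<in> P\<close> by (intro exI[of _ a] exI[of _ b]) (auto simp: less_imp_le)
next
  case False
  then obtain x0 where x0: "x0 \<in> C" "x0 \<in> P"
    by blast
  have conv: "convex P" "convex C"
    using P C polytope_imp_convex by blast+
  obtain VP VC where V: "finite VP" "P = convex hull VP" "finite VC" "C = convex hull VC"
    using P C unfolding polytope_def by blast
  let ?S = "(\<lambda>v. v - x0) ` VC" and ?T = "(\<lambda>v. x0 - v) ` VP"
  let ?M = "convex_cone hull (?S \<union> ?T)"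
  have ne: "?S \<noteq> {}" "?T \<noteq> {}"
    using V x0 by auto
  have hS: "convex hull ?S = (\<lambda>v. v - x0) ` C"
    using convex_hull_translation[of "-x0" VC] V(4) by simp
  have hT: "convex hull ?T = (\<lambda>v. x0 - v) ` P"
  proof -
    have "convex hull (uminus ` VP) = uminus ` P"
      using convex_hull_linear_image[OF linear_uminus, of VP] V(2) by simp
    then have "convex hull ((+) x0 ` uminus ` VP) = (+) x0 ` uminus ` P"
      using convex_hull_translation by metis
    then show ?thesis
      by (simp add: image_image)
  qed
  have "p - x0 \<notin> ?M"
  proof
    assume "p - x0 \<in> ?M"
    then obtain c s y t where eq: "p - x0 = s *\<^sub>R (c - x0) + t *\<^sub>R (x0 - y)"
      and cy: "c \<in> C" "y \<in> P" "0 \<le> s" "0 \<le> t"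
      unfolding convex_cone_hull_Un convex_cone_hull_separate_nonempty[OF ne(1)]
        convex_cone_hull_separate_nonempty[OF ne(2)] hS hT conic_hull_explicit by auto
    \<comment> \<open>This scale is small enough to turn both sides of \<open>eq\<close> into convex
      combinations: the same point then lies in \<open>C\<close> and, having positive weight
      \<open>l\<close> at \<open>p\<close>, in the relative interior of \<open>P\<close>.\<close>
    define l where "l = 1 / (2 + s + t)"
    have l: "0 < l" "l \<le> 1" "l * s \<le> 1" "l * t \<le> 1 - l" "l < 1"
      using cy by (auto simp: l_def field_simps)
    define w where "w = (1 - l * t / (1 - l)) *\<^sub>R x0 + (l * t / (1 - l)) *\<^sub>R y"
    have "w \<in> P"
      unfolding w_def using l cy x0 by (intro convexD_alt[OF conv(1)]) auto
    then have "(1 - l) *\<^sub>R w + l *\<^sub>R p \<in> rel_interior P"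
      using in_rel_interior_segment[OF conv(1) p] l by simp
    moreover have "(1 - l) * (1 - l * t / (1 - l)) = 1 - l - l * t"
      "(1 - l) * (l * t / (1 - l)) = l * t"
      using l(5) by (auto simp: right_diff_distrib)
    then have "(1 - l) *\<^sub>R w = (1 - l - l * t) *\<^sub>R x0 + (l * t) *\<^sub>R y"
      unfolding w_def by (simp only: scaleR_right_distrib scaleR_scaleR)
    then have "(1 - l) *\<^sub>R w + l *\<^sub>R p = x0 + l *\<^sub>R (p - x0) + (l * t) *\<^sub>R (y - x0)"
      by (simp add: algebra_simps)
    also have "\<dots> = (1 - l * s) *\<^sub>R x0 + (l * s) *\<^sub>R c"
      unfolding eq by (simp add: algebra_simps)
    also have "\<dots> \<in> C"
      using l cy x0 by (intro convexD_alt[OF conv(2)]) auto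
    ultimately show False
      using disj by blast
  qed
  moreover have "convex ?M" "closed ?M" "?M \<noteq> {}"
    using V convex_cone_hull_contains_0[of "?S \<union> ?T"]
    by (fastforce simp: convex_convex_cone_hull closed_convex_cone_hull)+
  ultimately obtain a' b where ab: "(a' - (p - x0)) \<bullet> (p - x0) < b"
    "\<And>x. x \<in> ?M \<Longrightarrow> b < (a' - (p - x0)) \<bullet> x"
    using separating_hyperplane_closed_point_inset by metis
  define a where "a = - (a' - (p - x0))"
  have "0 \<in> ?M"
    by (rule convex_cone_hull_contains_0)
  then have "b < 0"
    using ab(2) by force
  \<comment> \<open>The functional is bounded above on a cone, so it cannot be positive there:
    rescaling \<open>x\<close> to the value \<open>-b\<close> contradicts the strict bound.\<close>
  have neg: "a \<bullet> x \<le> 0" if "x \<in> ?M" for x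
  proof (rule ccontr)
    assume "\<not> a \<bullet> x \<le> 0"
    then have "0 \<le> - b / (a \<bullet> x)"
      using \<open>b < 0\<close> by (intro divide_nonneg_pos) auto
    then have "(- b / (a \<bullet> x)) *\<^sub>R x \<in> ?M"
      using that by (rule convex_cone_scaleR[OF convex_cone_convex_cone_hull])
    then have "b < - (a \<bullet> ((- b / (a \<bullet> x)) *\<^sub>R x))"
      using ab(2) unfolding a_def by (metis inner_minus_left minus_minus)
    then show False
      using \<open>\<not> a \<bullet> x \<le> 0\<close> by simp
  qed
  have "a \<bullet> y \<le> a \<bullet> x0" if "y \<in> C" for y
  proof -
    have "y - x0 \<in> ?M"
      using hS that hull_mono[of ?S "?S \<union> ?T" convex] convex_hull_subset_convex_cone_hull[of "?S \<union> ?T"]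
      by blast
    from neg[OF this] show ?thesis
      by (simp add: inner_diff_right)
  qed
  moreover have "a \<bullet> x0 \<le> a \<bullet> y" if "y \<in> P" for y
  proof -
    have "x0 - y \<in> ?M"
      using hT that hull_mono[of ?T "?S \<union> ?T" convex] convex_hull_subset_convex_cone_hull[of "?S \<union> ?T"]
      by blast
    from neg[OF this] show ?thesis
      by (simp add: inner_diff_right)
  qed
  moreover have "a \<bullet> x0 < a \<bullet> p"
    using ab(1) \<open>b < 0\<close> unfolding a_def by (simp add: inner_diff_right inner_diff_left)
  ultimately show ?thesis
    by blast
qed

text \<open>The segment from \<open>y\<close> to \<open>p\<close> can be prolonged slightly beyond
  \<open>p\<close> within \<open>P\<close>; a value above \<open>b\<close> at \<open>y\<close> would
  force one below \<open>b\<close> at its far end.\<close>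

lemma supporting_at_rel_interior:
  fixes P :: "'a::euclidean_space set"
  assumes "convex P" "p \<in> rel_interior P" "\<And>y. y \<in> P \<Longrightarrow> b \<le> a \<bullet> y" "a \<bullet> p = b" "y \<in> P"
  shows "a \<bullet> y = b"
proof -
  obtain e where e: "e > 1" "(1 - e) *\<^sub>R y + e *\<^sub>R p \<in> P"
    using convex_rel_interior_iff[OF assms(1)] assms(2,5) by blast
  then have "b \<le> (1 - e) * (a \<bullet> y) + e * b"
    using assms(3)[OF e(2)] assms(4) by (simp add: inner_add_right)
  then have "(e - 1) * (a \<bullet> y) \<le> (e - 1) * b"
    by (simp add: algebra_simps)
  then have "a \<bullet> y \<le> b"
    using e(1) by simp
  then show ?thesis
    using assms(3,5) by (simp add: order_antisym)
qed

text \<open>\<open>H\<close> consists of the facet hyperplanes of a thin bipyramid \<open>Q\<close> over \<open>P\<close>, with apexes \<open>p \<plusminus> \<epsilon> e\<close>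
  for \<open>e\<close> in a basis of the orthogonal complement of \<open>P\<close> in \<open>W\<close>, and of hyperplanes through \<open>P\<close>
  cutting out its affine hull.\<close>

lemma thin_neighbourhood:
  fixes P W :: "'a::euclidean_space set"
  assumes W: "subspace W" and P: "polytope P" "P \<subseteq> W" and p: "p \<in> rel_interior P"
    and fin: "bounded_finite \<C>"
    and \<C>: "\<And>C. C \<in> \<C> \<Longrightarrow> polytope C \<and> C \<inter> rel_interior P = {}"
  obtains H where "finite H" "\<And>a b y. (a, b) \<in> H \<Longrightarrow> y \<in> P \<Longrightarrow> b \<le> a \<bullet> y"
    "W \<inter> sign_cell H p = P"
    "bounded {x \<in> W. \<forall>(a, b)\<in>H. b < a \<bullet> p \<longrightarrow> b \<le> a \<bullet> x}"
    "\<And>C. C \<in> \<C> \<Longrightarrow> {x \<in> W. \<forall>(a, b)\<in>H. b < a \<bullet> p \<longrightarrow> b \<le> a \<bullet> x} \<inter> C \<subseteq> P"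
proof -
  have convP: "convex P" and pP: "p \<in> P"
    using P(1) polytope_imp_convex p rel_interior_subset by blast+
  \<comment> \<open>The directions of \<open>W\<close> orthogonal to \<open>P\<close>; the bipyramid
    widens \<open>P\<close> only in these.\<close>
  define V where "V = {v \<in> W. \<forall>y\<in>P. v \<bullet> (y - p) = 0}"
  have subV: "subspace V"
    using W unfolding V_def subspace_def by (auto simp: inner_add_left)
  obtain B where B: "B \<subseteq> V" "independent B" "span B = V"
    using orthonormal_basis_subspace[OF subV] by metis
  have finB: "finite B"
    using B(2) by (rule finiteI_independent)
  define G where "G \<epsilon> = insert p ((\<lambda>e. p + \<epsilon> *\<^sub>R e) ` B \<union> (\<lambda>e. p - \<epsilon> *\<^sub>R e) ` B)" for \<epsilon> :: real
  have finG: "finite (G \<epsilon>)" for \<epsilon>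
    unfolding G_def using finB by simp
  define Q where "Q \<epsilon> = convex hull (P \<union> G \<epsilon>)" for \<epsilon>
  have polyQ: "polytope (Q \<epsilon>)" for \<epsilon>
  proof -
    obtain VP where VP: "finite VP" "P = convex hull VP"
      using P(1) polytope_def by blast
    have "Q \<epsilon> = convex hull (VP \<union> G \<epsilon>)"
      unfolding Q_def VP(2) by (metis hull_Un_left)
    then show ?thesis
      using VP(1) finG polytope_def by blast
  qed
  have Qpt: "\<exists>y\<in>P. \<exists>z\<in>convex hull (G \<epsilon>). \<exists>t. 0 \<le> t \<and> t \<le> 1 \<and> x = (1 - t) *\<^sub>R y + t *\<^sub>R z"
    if "x \<in> Q \<epsilon>" for x \<epsilon>
  proof -
    have ne: "convex hull (G \<epsilon>) \<noteq> {}" "P \<noteq> {}"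
      using pP by (auto simp: G_def)
    have "Q \<epsilon> = convex hull (P \<union> convex hull (G \<epsilon>))"
      unfolding Q_def by (rule hull_Un_right)
    also have "\<dots> = {u *\<^sub>R s + v *\<^sub>R t |u v s t. u \<ge> 0 \<and> v \<ge> 0 \<and> u + v = 1 \<and>
        s \<in> P \<and> t \<in> convex hull (G \<epsilon>)}"
      by (rule convex_hull_union_two[OF convP ne(2) convex_convex_hull ne(1)])
    finally have "x \<in> \<dots>"
      using that by simp
    then obtain u v y z where "0 \<le> u" "0 \<le> v" "u + v = 1" "y \<in> P" "z \<in> convex hull (G \<epsilon>)"
      "x = u *\<^sub>R y + v *\<^sub>R z"
      by blast
    then show ?thesis
      by (intro bexI[of _ y] bexI[of _ z] exI[of _ v]) (auto simp: eq_diff_eq)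
  qed
  obtain r where r: "P \<union> G 1 \<subseteq> cball p r"
  proof -
    have "bounded (P \<union> G 1)"
      using polytope_imp_bounded[OF P(1)] finite_imp_bounded[OF finG] by simp
    then show ?thesis
      using bounded_subset_ballD[of "P \<union> G 1" p] ball_subset_cball that by (meson order_trans)
  qed
  have Qr: "Q \<epsilon> \<subseteq> cball p r" if "0 < \<epsilon>" "\<epsilon> \<le> 1" for \<epsilon>
  proof -
    have "norm e \<le> r" if "e \<in> B" for e
    proof -
      have "p + e \<in> cball p r"
        using r that unfolding G_def by auto
      then show ?thesis
        by (simp add: dist_norm)
    qed
    then have "\<epsilon> * norm e \<le> r" if "e \<in> B" for e
      using that \<open>\<epsilon> \<le> 1\<close> \<open>0 < \<epsilon>\<close> mult_left_le_one_le[of "norm e" \<epsilon>] by (meson norm_ge_zero order.trans less_imp_le)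
    then have "P \<union> G \<epsilon> \<subseteq> cball p r"
      using r \<open>0 < \<epsilon>\<close> unfolding G_def by (auto simp: dist_norm)
    then show ?thesis
      unfolding Q_def by (intro hull_minimal) auto
  qed
  \<comment> \<open>All \<open>Q \<epsilon>\<close> with \<open>\<epsilon> \<le> 1\<close> lie in
    one ball, so only finitely many members of the family restrict the choice of
    \<open>\<epsilon>\<close>.\<close>
  let ?C = "{C \<in> \<C>. C \<inter> cball p r \<noteq> {}}"
  have "finite ?C"
    by (rule bounded_finiteD[OF fin]) simp
  \<comment> \<open>A hyperplane separates \<open>C\<close> from \<open>P\<close> strictly at
    \<open>p\<close>. For small \<open>\<epsilon>\<close> the apexes stay strictly on the side of
    \<open>p\<close>, so a point of \<open>Q \<epsilon>\<close> can reach \<open>C\<close> only if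
    it has no weight on \<open>convex hull (G \<epsilon>)\<close>.\<close>
  moreover have "\<forall>\<^sub>F \<epsilon> in at_right 0. Q \<epsilon> \<inter> C \<subseteq> P" if C: "C \<in> ?C" for C
  proof -
    obtain a b where ab: "\<forall>y\<in>P. b \<le> a \<bullet> y" "\<forall>y\<in>C. a \<bullet> y \<le> b" "b < a \<bullet> p"
      using separate_rel_interior_polytope[OF P(1) _ p, of C] \<C>[of C] C by blast
    have "\<forall>\<^sub>F \<epsilon> in at_right 0. b < a \<bullet> (p + \<epsilon> *\<^sub>R e) \<and> b < a \<bullet> (p - \<epsilon> *\<^sub>R e)" for e
    proof (intro eventually_conj)
      have "((\<lambda>\<epsilon>. a \<bullet> (p + \<epsilon> *\<^sub>R e)) \<longlongrightarrow> a \<bullet> (p + 0 *\<^sub>R e)) (at_right 0)"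
        "((\<lambda>\<epsilon>. a \<bullet> (p - \<epsilon> *\<^sub>R e)) \<longlongrightarrow> a \<bullet> (p - 0 *\<^sub>R e)) (at_right 0)"
        by (intro tendsto_intros)+
      then show "\<forall>\<^sub>F \<epsilon> in at_right 0. b < a \<bullet> (p + \<epsilon> *\<^sub>R e)" "\<forall>\<^sub>F \<epsilon> in at_right 0. b < a \<bullet> (p - \<epsilon> *\<^sub>R e)"
        using ab(3) by (auto intro: order_tendstoD)
    qed
    then have "\<forall>\<^sub>F \<epsilon> in at_right 0. \<forall>e\<in>B. b < a \<bullet> (p + \<epsilon> *\<^sub>R e) \<and> b < a \<bullet> (p - \<epsilon> *\<^sub>R e)"
      using finB by (intro eventually_ball_finite) auto
    then show ?thesis
    proof (rule eventually_mono)
      fix \<epsilon> assume e: "\<forall>e\<in>B. b < a \<bullet> (p + \<epsilon> *\<^sub>R e) \<and> b < a \<bullet> (p - \<epsilon> *\<^sub>R e)"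
      then have "G \<epsilon> \<subseteq> {x. b < a \<bullet> x}"
        using ab(3) unfolding G_def by auto
      then have hullG: "convex hull (G \<epsilon>) \<subseteq> {x. b < a \<bullet> x}"
        by (intro hull_minimal) (auto simp: convex_halfspace_gt)
      show "Q \<epsilon> \<inter> C \<subseteq> P"
      proof
        fix x assume x: "x \<in> Q \<epsilon> \<inter> C"
        then obtain y z t where yzt: "y \<in> P" "z \<in> convex hull (G \<epsilon>)" "0 \<le> t" "t \<le> 1"
          "x = (1 - t) *\<^sub>R y + t *\<^sub>R z"
          using Qpt by blast
        have "t = 0"
        proof (rule ccontr)
          assume "t \<noteq> 0"
          then have "t * b < t * (a \<bullet> z)"
            using yzt hullG by auto
          moreover have "(1 - t) * b \<le> (1 - t) * (a \<bullet> y)"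
            using yzt ab(1) by (intro mult_left_mono) auto
          moreover have "(1 - t) * b + t * b = b"
            by (simp add: algebra_simps)
          ultimately have "b < a \<bullet> x"
            unfolding yzt(5) by (simp only: inner_add_right inner_scaleR_right)
          then show False
            using ab(2) x by force
        qed
        then show "x \<in> P"
          using yzt by simp
      qed
    qed
  qed
  ultimately have "\<forall>\<^sub>F \<epsilon> in at_right 0. \<forall>C\<in>?C. Q \<epsilon> \<inter> C \<subseteq> P"
    by (intro eventually_ball_finite) auto
  moreover have "\<forall>\<^sub>F \<epsilon> in at_right (0::real). 0 < \<epsilon> \<and> \<epsilon> \<le> 1"
    by (auto simp: eventually_at_right_field intro!: exI[of _ 1])
  ultimately have "\<forall>\<^sub>F \<epsilon> in at_right 0. (\<forall>C\<in>?C. Q \<epsilon> \<inter> C \<subseteq> P) \<and> 0 < \<epsilon> \<and> \<epsilon> \<le> 1"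
    by (rule eventually_conj)
  then obtain \<epsilon> where \<epsilon>: "\<forall>C\<in>?C. Q \<epsilon> \<inter> C \<subseteq> P" "0 < \<epsilon>" "\<epsilon> \<le> 1"
    using eventually_happens'[OF trivial_limit_at_right_real] by blast
  have QC: "Q \<epsilon> \<inter> C \<subseteq> P" if "C \<in> \<C>" for C
    using \<epsilon>(1) Qr[OF \<epsilon>(2,3)] that by blast
  have "polyhedron (Q \<epsilon>)"
    using polyQ polytope_imp_polyhedron by blast
  then obtain F where F: "finite F" "Q \<epsilon> = \<Inter>F" "\<forall>h\<in>F. \<exists>a b. a \<noteq> 0 \<and> h = {x. a \<bullet> x \<le> b}"
    unfolding polyhedron_def by blast
  have "\<exists>a b. \<forall>x. x \<in> h \<longleftrightarrow> a \<bullet> x \<le> b" if "h \<in> F" for h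
    using F(3) that by force
  then obtain af bf where ab: "\<And>h x. h \<in> F \<Longrightarrow> x \<in> h \<longleftrightarrow> af h \<bullet> x \<le> bf h"
    by metis
  define H where "H = (\<lambda>h. (- af h, - bf h)) ` F \<union> (\<lambda>e. (e, e \<bullet> p)) ` B"
  define Q' where "Q' = {x \<in> W. \<forall>(a, b)\<in>H. b < a \<bullet> p \<longrightarrow> b \<le> a \<bullet> x}"
  have PQ: "P \<subseteq> Q \<epsilon>" "G \<epsilon> \<subseteq> Q \<epsilon>"
    unfolding Q_def using hull_subset[of "P \<union> G \<epsilon>" convex] by auto
  have B_P: "e \<bullet> y = e \<bullet> p" if "e \<in> B" "y \<in> P" for e y
  proof -
    have "e \<bullet> (y - p) = 0"
      using B(1) that unfolding V_def by blast
    then show ?thesis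
      by (simp add: inner_diff_right)
  qed
  have nonneg: "b \<le> a \<bullet> y" if "(a, b) \<in> H" "y \<in> P" for a b y
  proof -
    consider h where "h \<in> F" "a = - af h" "b = - bf h" | "a \<in> B" "b = a \<bullet> p"
      using \<open>(a, b) \<in> H\<close> unfolding H_def by blast
    then show ?thesis
    proof cases
      case 1
      then have "y \<in> h"
        using PQ(1) that(2) F(2) by blast
      then show ?thesis
        using 1 ab[OF 1(1), of y] by simp
    next
      case 2
      then show ?thesis
        using B_P that(2) by simp
    qed
  qed
  \<comment> \<open>A facet inequality of \<open>Q \<epsilon>\<close> that is tight at
    \<open>p\<close> is tight on all of \<open>P\<close> and in both directions of each basis vector
    of \<open>V\<close>, hence on all of \<open>W\<close>. So only inequalities strict at
    \<open>p\<close> restrict \<open>W\<close>, which is why \<open>Q'\<close> lists just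
    these.\<close>
  have vanish: "af h \<bullet> x = bf h" if h: "h \<in> F" "af h \<bullet> p = bf h" and x: "x \<in> W" for h x
  proof -
    have le: "af h \<bullet> y \<le> bf h" if "y \<in> Q \<epsilon>" for y
      using that F(2) ab[OF h(1), of y] h(1) by blast
    have P0: "af h \<bullet> (y - p) = 0" if "y \<in> P" for y
    proof -
      have "- bf h \<le> - af h \<bullet> z" if "z \<in> P" for z
        using le[of z] PQ(1) that by (simp add: subsetD)
      then have "- af h \<bullet> y = - bf h"
        by (rule supporting_at_rel_interior[OF convP p]) (simp_all add: h(2) that)
      then show ?thesis
        using h(2) by (simp add: inner_diff_right)
    qed
    have B0: "af h \<bullet> e = 0" if "e \<in> B" for e
    proof -
      have "p + \<epsilon> *\<^sub>R e \<in> Q \<epsilon>" "p - \<epsilon> *\<^sub>R e \<in> Q \<epsilon>"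
        using PQ(2) that unfolding G_def by auto
      then have "\<epsilon> * (af h \<bullet> e) \<le> 0" "- (\<epsilon> * (af h \<bullet> e)) \<le> 0"
        using le[of "p + \<epsilon> *\<^sub>R e"] le[of "p - \<epsilon> *\<^sub>R e"] h(2)
        by (simp_all add: inner_add_right inner_diff_right)
      then show ?thesis
        using \<epsilon>(2) by simp
    qed
    have spanB: "af h \<bullet> v = 0" if "v \<in> V" for v
      using that unfolding B(3)[symmetric]
      by (induction rule: span_induct_alt) (auto simp: inner_add_right B0)
    have spanP: "af h \<bullet> v = 0" if "v \<in> span ((\<lambda>y. y - p) ` P)" for v
      using that by (induction rule: span_induct_alt) (auto simp: inner_add_right P0)
    obtain u v where uv: "u \<in> span ((\<lambda>y. y - p) ` P)"
      "\<And>w. w \<in> span ((\<lambda>y. y - p) ` P) \<Longrightarrow> orthogonal v w" "x - p = u + v"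
      using orthogonal_subspace_decomp_exists by metis
    have "span ((\<lambda>y. y - p) ` P) \<subseteq> W"
      using W P(2) pP by (intro span_minimal) (auto intro: subspace_diff)
    then have "v \<in> W"
      using uv(1,3) W x P(2) pP by (metis add_diff_cancel_left' subsetD subspace_diff)
    then have "v \<in> V"
      using uv(2) span_base unfolding V_def orthogonal_def by blast
    then have "af h \<bullet> (x - p) = 0"
      unfolding uv(3) inner_add_right using spanB spanP uv(1) by simp
    then show ?thesis
      using h(2) by (simp add: inner_diff_right)
  qed
  have Q'Q: "Q' \<subseteq> Q \<epsilon>"
  proof
    fix x assume x: "x \<in> Q'"
    have "x \<in> h" if h: "h \<in> F" for h
    proof (cases "af h \<bullet> p = bf h")
      case True
      then show ?thesis
        using vanish[OF h True, of x] x ab[OF h, of x] unfolding Q'_def by simp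
    next
      case False
      have "p \<in> h"
        using pP PQ(1) F(2) h by blast
      then have "af h \<bullet> p < bf h"
        using False ab[OF h, of p] by simp
      moreover have "(- af h, - bf h) \<in> H"
        unfolding H_def using h by blast
      ultimately have "- bf h \<le> - af h \<bullet> x"
        using x unfolding Q'_def by force
      then show ?thesis
        using ab[OF h, of x] by simp
    qed
    then show "x \<in> Q \<epsilon>"
      unfolding F(2) by blast
  qed
  show ?thesis
  proof (rule that[of H])
    show "finite H"
      unfolding H_def using F(1) finB by simp
    show "b \<le> a \<bullet> y" if "(a, b) \<in> H" "y \<in> P" for a b y
      using nonneg that .
    show "bounded {x \<in> W. \<forall>(a, b)\<in>H. b < a \<bullet> p \<longrightarrow> b \<le> a \<bullet> x}"
      using Q'Q polyQ polytope_imp_bounded bounded_subset unfolding Q'_def by blast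
    show "{x \<in> W. \<forall>(a, b)\<in>H. b < a \<bullet> p \<longrightarrow> b \<le> a \<bullet> x} \<inter> C \<subseteq> P" if "C \<in> \<C>" for C
      using Q'Q QC[OF that] unfolding Q'_def by blast
    show "W \<inter> sign_cell H p = P"
    proof (intro equalityI subsetI)
      fix y assume y: "y \<in> P"
      have "y \<in> side p (a, b)" if ab: "(a, b) \<in> H" for a b
        using supporting_at_rel_interior[OF convP p nonneg[OF ab] _ y] nonneg[OF ab y]
          nonneg[OF ab pP] unfolding side_cases by auto
      then show "y \<in> W \<inter> sign_cell H p"
        using y P(2) unfolding sign_cell_def by auto
    next
      fix x assume x: "x \<in> W \<inter> sign_cell H p"
      then have sx: "x \<in> side p (a, b)" if "(a, b) \<in> H" for a b
        using that unfolding sign_cell_def by blast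
      then have "x \<in> Q'"
        using x unfolding Q'_def side_def by auto
      then obtain y z t where yzt: "y \<in> P" "z \<in> convex hull (G \<epsilon>)" "0 \<le> t" "t \<le> 1"
        "x = (1 - t) *\<^sub>R y + t *\<^sub>R z"
        using Qpt Q'Q by blast
      have xe: "e \<bullet> (x - p) = 0" if "e \<in> B" for e
      proof -
        have "(e, e \<bullet> p) \<in> H"
          unfolding H_def using that by blast
        then show ?thesis
          using sx[of e "e \<bullet> p"] by (simp add: side_cases inner_diff_right)
      qed
      have xV: "v \<bullet> (x - p) = 0" if "v \<in> V" for v
        using that unfolding B(3)[symmetric]
        by (induction rule: span_induct_alt) (auto simp: inner_add_left xe)
      have "G \<epsilon> \<subseteq> (+) p ` V"
      proof -
        have "e \<in> V" if "e \<in> B" for e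
          using B(1) that by blast
        then have "0 \<in> V" "\<epsilon> *\<^sub>R e \<in> V" "- (\<epsilon> *\<^sub>R e) \<in> V" if "e \<in> B" for e
          using subV that by (auto simp: subspace_0 subspace_scale subspace_neg)
        then show ?thesis
          unfolding G_def using subspace_0[OF subV] by (force simp: image_iff)
      qed
      then have "convex hull (G \<epsilon>) \<subseteq> (+) p ` V"
        using subspace_imp_convex[OF subV] by (intro hull_minimal) (auto simp: convex_translation_eq)
      then obtain v where v: "v \<in> V" "z = p + v"
        using yzt(2) by blast
      have "x - p = (1 - t) *\<^sub>R (y - p) + t *\<^sub>R v"
        unfolding yzt(5) v(2) by (simp add: algebra_simps)
      \<comment> \<open>Pairing with \<open>v\<close> itself removes the part along
        \<open>P\<close>. The left side vanishes by the hyperplanes from \<open>B\<close>, leaving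
        \<open>t * (v \<bullet> v) = 0\<close>, so \<open>x\<close> has no component off
        \<open>P\<close>.\<close>
      then have "v \<bullet> (x - p) = (1 - t) * (v \<bullet> (y - p)) + t * (v \<bullet> v)"
        by (simp add: inner_add_right)
      moreover have "v \<bullet> (y - p) = 0"
        using v(1) yzt(1) unfolding V_def by blast
      ultimately have "t = 0 \<or> v = 0"
        using xV[OF v(1)] by simp
      then have "x = (1 - t) *\<^sub>R y + t *\<^sub>R p"
        using yzt(5) v(2) by auto
      then show "x \<in> P"
        using convexD_alt[OF convP yzt(1) pP yzt(3,4)] by simp
    qed
  qed
qed

section \<open>Adding one cell\<close>

locale cell_insertion =
  fixes W :: "'a::euclidean_space set" and \<Phi> :: "'a set set" and P :: "'a set"
  assumes W: "subspace W"
    and \<Phi>ne: "{} \<notin> \<Phi>"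
    and \<Phi>face: "\<And>F G. F \<in> \<Phi> \<Longrightarrow> G face_of F \<Longrightarrow> G \<noteq> {} \<Longrightarrow> G \<in> \<Phi>"
    and P: "polytope P" "P \<subseteq> W" "P \<noteq> {}"
    and Pface: "\<And>F. F face_of P \<Longrightarrow> F \<noteq> P \<Longrightarrow> F \<noteq> {} \<Longrightarrow> F \<in> \<Phi>"
    and compat: "\<And>F. F \<in> \<Phi> \<Longrightarrow> F \<inter> P face_of F"
    and disj: "\<And>F. F \<in> \<Phi> \<Longrightarrow> F \<inter> rel_interior P = {}"
begin

lemma convP: "convex P"
  using P(1) polytope_imp_convex by blast

lemma boundary_cell:
  assumes "x \<in> P" "x \<notin> rel_interior P"
  shows "\<exists>F\<in>\<Phi>. x \<in> F \<and> F \<subseteq> P"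
proof -
  obtain F where F: "F face_of P" "x \<in> rel_interior F"
    using exists_face_rel_interior P(1) assms(1) by blast
  then have "F \<noteq> P" "F \<noteq> {}"
    using assms(2) by auto
  then have "F \<in> \<Phi>"
    using Pface F(1) by blast
  then show ?thesis
    using F face_of_imp_subset rel_interior_subset by blast
qed

text \<open>A cell \<open>C\<close> outside \<open>\<Phi>\<close> meets \<open>P\<close> in its relative interior only along an affine section, since
  the relative boundary of \<open>P\<close> is covered by \<open>\<Phi>\<close>.  Coning with apexes on \<open>P\<close> therefore makes
  every intersection with \<open>P\<close> a face.\<close>

lemma subdivide_along:
  assumes \<Psi>: "complete_complex W \<Psi>" "\<Phi> \<subseteq> \<Psi>"
  shows "\<exists>\<Psi>'. complete_complex W \<Psi>' \<and> \<Phi> \<subseteq> \<Psi>' \<and> (\<forall>X\<in>\<Psi>'. X \<inter> P face_of X)"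
proof -
  note C\<Psi> = complete_complexD[OF \<Psi>(1)]
  note cpx = polytopal_complexD[OF C\<Psi>(1)]
  define c where "c C = (SOME x. x \<in> rel_interior C \<and>
    (rel_interior C \<inter> rel_interior P \<noteq> {} \<longrightarrow> x \<in> rel_interior P))" for C
  have c: "c C \<in> rel_interior C \<and> (rel_interior C \<inter> rel_interior P \<noteq> {} \<longrightarrow> c C \<in> rel_interior P)"
    if "C \<in> \<Psi>" for C
  proof -
    have "C \<noteq> {}"
      using that C\<Psi>(2) by blast
    then have "rel_interior C \<noteq> {}"
      using rel_interior_eq_empty[OF cpx(3)[OF that]] by simp
    then have "\<exists>x. x \<in> rel_interior C \<and> (rel_interior C \<inter> rel_interior P \<noteq> {} \<longrightarrow> x \<in> rel_interior P)"
      by blast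
    then show ?thesis
      unfolding c_def by (rule someI_ex)
  qed
  interpret coning W \<Psi> \<Phi> c
    by unfold_locales (use complete_complex_cellulation \<Psi> \<Phi>face c in auto)
  \<comment> \<open>A relative boundary point of \<open>P\<close> lies in a member of
    \<open>\<Phi>\<close>; if it were also a relative interior point of \<open>C\<close>, then
    \<open>C\<close> would be a face of that member and hence belong to
    \<open>\<Phi>\<close>.\<close>
  have inside: "z \<in> rel_interior P" if C: "C \<in> \<Psi>" "C \<notin> \<Phi>" and z: "z \<in> rel_interior C" "z \<in> P" for C z
  proof (rule ccontr)
    assume "z \<notin> rel_interior P"
    then obtain F where F: "F \<in> \<Phi>" "z \<in> F"
      using boundary_cell z(2) by blast
    then have "C face_of F"
      using polytopal_complex_subset_cell(2)[OF C\<Psi>(1) C(1), of F] \<Psi>(2) z(1) by blast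
    then show False
      using \<Phi>face[OF F(1), of C] C C\<Psi>(2) by blast
  qed
  \<comment> \<open>The hypotheses put \<open>y\<close> in the affine hull of \<open>P\<close>, so
    the ray from the apex through \<open>y\<close> leaves \<open>P\<close> at a relative boundary
    point. If it did so before \<open>y\<close>, that point would be in the relative interior of
    \<open>C\<close>, which \<open>inside\<close> forbids.\<close>
  have ray: "y \<in> P" if C: "C \<in> \<Psi>" "C \<notin> \<Phi>" and cC: "c C \<in> rel_interior P"
    and y: "y \<in> C" and t: "0 \<le> t" "t < 1" and z: "(1 - t) *\<^sub>R y + t *\<^sub>R c C \<in> P" for C y t
  proof (cases "y = c C")
    case True
    then show ?thesis
      using cC rel_interior_subset by blast
  next
    case False
    have cC': "c C \<in> rel_interior C" "convex C"
      using c C(1) cpx(3) by auto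
    have "(1 / (1 - t)) *\<^sub>R ((1 - t) *\<^sub>R y + t *\<^sub>R c C) + (1 - 1 / (1 - t)) *\<^sub>R c C = y"
    proof -
      have "1 / (1 - t) * t + (1 - 1 / (1 - t)) = 0"
        using t(2) by (simp add: field_simps)
      then have "(1 / (1 - t) * t) *\<^sub>R c C + (1 - 1 / (1 - t)) *\<^sub>R c C = 0"
        by (metis scaleR_left_distrib scaleR_zero_left)
      then show ?thesis
        using t(2) by (simp only: scaleR_right_distrib scaleR_scaleR add.assoc) simp
    qed
    moreover have "c C \<in> affine hull P" "(1 - t) *\<^sub>R y + t *\<^sub>R c C \<in> affine hull P"
      using cC z rel_interior_subset hull_inc by (metis subsetD)+
    ultimately have aff: "y \<in> affine hull P"
      using mem_affine[OF affine_affine_hull, of _ P "c C" "1 / (1 - t)" "1 - 1 / (1 - t)"]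
      by (metis add.commute diff_add_cancel)
    obtain d where d: "0 < d" "c C + d *\<^sub>R (y - c C) \<in> rel_frontier P"
      "\<And>e. 0 \<le> e \<Longrightarrow> e < d \<Longrightarrow> c C + e *\<^sub>R (y - c C) \<in> rel_interior P"
    proof (rule ray_to_rel_frontier[of P "c C" "y - c C"])
      show "bounded P"
        using P(1) polytope_imp_bounded by blast
    qed (use False aff cC in auto)
    have w: "c C + d *\<^sub>R (y - c C) \<in> P" "c C + d *\<^sub>R (y - c C) \<notin> rel_interior P"
      using d(2) closure_closed[OF polytope_imp_closed[OF P(1)]] unfolding rel_frontier_def by auto
    show ?thesis
    proof (cases "d < 1")
      case True
      have "(1 - (1 - d)) *\<^sub>R y + (1 - d) *\<^sub>R c C \<in> rel_interior C"
        using True d(1) by (intro in_rel_interior_segment[OF cC'(2,1) y]) auto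
      moreover have "(1 - (1 - d)) *\<^sub>R y + (1 - d) *\<^sub>R c C = c C + d *\<^sub>R (y - c C)"
        by (simp add: algebra_simps)
      ultimately show ?thesis
        using inside[OF C _ w(1)] w(2) by simp
    next
      case False
      then show ?thesis
        using w(1) d(3)[of 1] rel_interior_subset[of P] by (cases "d = 1") auto
    qed
  qed
  have "X \<inter> P face_of X" if "X \<in> cells" for X
  proof (rule cells_Int_face[OF _ compat that])
    fix C assume C: "C \<in> \<Psi>" "C \<notin> \<Phi>"
    show "rel_interior C \<inter> P = {} \<or> (c C \<in> P \<and>
        (\<forall>y\<in>C. \<forall>t. 0 \<le> t \<and> t < 1 \<longrightarrow> ((1 - t) *\<^sub>R y + t *\<^sub>R c C \<in> P \<longleftrightarrow> y \<in> P)))"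
    proof (cases "rel_interior C \<inter> P = {}")
      case False
      then have "rel_interior C \<inter> rel_interior P \<noteq> {}"
        using inside[OF C] by blast
      then have cC: "c C \<in> rel_interior P"
        using c[OF C(1)] by blast
      then have "c C \<in> P"
        using rel_interior_subset by blast
      then have "(1 - t) *\<^sub>R y + t *\<^sub>R c C \<in> P" if "y \<in> P" "0 \<le> t" "t < 1" for y t
        using convexD_alt[OF convP that(1), of "c C" t] that by simp
      then show ?thesis
        using ray[OF C cC] \<open>c C \<in> P\<close> by blast
    qed simp
  qed
  then show ?thesis
    using complete_complex_cells kept_cells by blast
qed

text \<open>Coning with \<open>K\<close> kept makes it a full subcomplex: a new cell meets its union
  in the empty set or in a single cell of \<open>K\<close>. For a cell meeting the relative interior
  of \<open>P\<close>, this single cell meets it as well, so it is not in \<open>\<Phi>\<close> and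
  must lie inside \<open>P\<close>.\<close>

lemma subdivide_full:
  assumes \<Psi>: "complete_complex W \<Psi>" "\<Phi> \<subseteq> \<Psi>" "\<forall>X\<in>\<Psi>. X \<inter> P face_of X"
  shows "\<exists>\<Psi>'. complete_complex W \<Psi>' \<and> \<Phi> \<subseteq> \<Psi>' \<and>
    (\<forall>X\<in>\<Psi>'. X \<inter> rel_interior P \<noteq> {} \<longrightarrow> X \<inter> \<Union>\<Phi> \<subseteq> P) \<and>
    (\<forall>X\<in>\<Psi>'. rel_interior X \<inter> P \<noteq> {} \<longrightarrow> X \<subseteq> P)"
proof -
  note C\<Psi> = complete_complexD[OF \<Psi>(1)]
  note cpx = polytopal_complexD[OF C\<Psi>(1)]
  define K where "K = \<Phi> \<union> {A \<in> \<Psi>. A \<subseteq> P}"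
  have K: "K \<subseteq> \<Psi>"
    using \<Psi>(2) unfolding K_def by blast
  have Kface: "G \<in> K" if "F \<in> K" "G face_of F" "G \<noteq> {}" for F G
  proof (cases "F \<in> \<Phi>")
    case True
    then show ?thesis
      using \<Phi>face[OF True that(2,3)] unfolding K_def by simp
  next
    case False
    then have F: "F \<in> \<Psi>" "F \<subseteq> P"
      using that(1) unfolding K_def by auto
    then show ?thesis
      using cpx(4)[OF F(1) that(2,3)] face_of_imp_subset[OF that(2)] unfolding K_def by auto
  qed
  define c where "c C = (SOME x. x \<in> rel_interior C)" for C :: "'a set"
  have c: "c C \<in> rel_interior C" if "C \<in> \<Psi>" for C
  proof -
    have "C \<noteq> {}"
      using that C\<Psi>(2) by blast
    then have "rel_interior C \<noteq> {}"
      using rel_interior_eq_empty[OF cpx(3)[OF that]] by simp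
    then show ?thesis
      unfolding c_def by (simp add: some_in_eq)
  qed
  interpret coning W \<Psi> K c
    by unfold_locales (use complete_complex_cellulation[OF \<Psi>(1)] K Kface c in auto)
  note Ccells = complete_complexD[OF complete_complex_cells]
  \<comment> \<open>Stated for an arbitrary complex containing \<open>K\<close>, as it is used both
    before and after the subdivision.\<close>
  have meets_K: "X \<in> K" if \<Xi>: "polytopal_complex W \<Xi>" "K \<subseteq> \<Xi>" "{} \<notin> \<Xi>"
    and X: "X \<in> \<Xi>" "rel_interior X \<inter> \<Union>K \<noteq> {}" for X \<Xi>
  proof -
    obtain A where A: "A \<in> K" "rel_interior X \<inter> A \<noteq> {}"
      using X(2) by blast
    then have "X face_of A"
      using polytopal_complex_subset_cell(2)[OF \<Xi>(1) X(1), of A] \<Xi>(2) by blast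
    then show ?thesis
      using Kface[OF A(1), of X] X(1) \<Xi>(3) by blast
  qed
  have full: "X \<inter> \<Union>K face_of X" if "X \<in> cells" for X
  proof (rule cells_Int_face[OF _ _ that])
    show "rel_interior C \<inter> \<Union>K = {} \<or> (c C \<in> \<Union>K \<and>
        (\<forall>y\<in>C. \<forall>t. 0 \<le> t \<and> t < 1 \<longrightarrow> ((1 - t) *\<^sub>R y + t *\<^sub>R c C \<in> \<Union>K \<longleftrightarrow> y \<in> \<Union>K)))"
      if "C \<in> \<Psi>" "C \<notin> K" for C
      using meets_K[OF C\<Psi>(1) K C\<Psi>(2) that(1)] that(2) by blast
    show "F \<inter> \<Union>K face_of F" if "F \<in> K" for F
    proof -
      have "F \<inter> \<Union>K = F"
        using that by blast
      then show ?thesis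
        using face_of_refl[OF cpx(3), of F] that K by auto
    qed
  qed
  \<comment> \<open>Since \<open>P\<close> meets every old cell in a face, it is a union of old
    cells.\<close>
  have PK: "P \<subseteq> \<Union>K"
  proof
    fix x assume x: "x \<in> P"
    then obtain X where X: "X \<in> \<Psi>" "x \<in> X"
      using P(2) C\<Psi>(4) by blast
    then have "X \<inter> P \<in> \<Psi>"
      using cpx(4)[OF X(1), of "X \<inter> P"] \<Psi>(3) x by blast
    then show "x \<in> \<Union>K"
      using x X unfolding K_def by blast
  qed
  have "X \<inter> \<Union>\<Phi> \<subseteq> P" if X: "X \<in> cells" "X \<inter> rel_interior P \<noteq> {}" for X
  proof -
    let ?Y = "X \<inter> \<Union>K"
    have XP: "X \<inter> rel_interior P \<subseteq> ?Y"
      using PK rel_interior_subset[of P] by blast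
    then have ne: "?Y \<noteq> {}"
      using X(2) by blast
    then have Y: "?Y \<in> cells"
      using polytopal_complexD(4)[OF Ccells(1) X(1) full[OF X(1)]] by blast
    then have "rel_interior ?Y \<noteq> {}"
      using rel_interior_eq_empty[OF polytopal_complexD(3)[OF Ccells(1) Y]] ne by simp
    then have "rel_interior ?Y \<inter> \<Union>K \<noteq> {}"
      using rel_interior_subset[of ?Y] by blast
    then have "?Y \<in> K"
      using meets_K[OF Ccells(1) kept_cells Ccells(2) Y] by blast
    moreover have "?Y \<notin> \<Phi>"
      using disj[of ?Y] XP X(2) by blast
    ultimately have "?Y \<subseteq> P"
      unfolding K_def by blast
    then show ?thesis
      unfolding K_def by blast
  qed
  moreover have "X \<subseteq> P" if X: "X \<in> cells" "rel_interior X \<inter> P \<noteq> {}" for X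
  proof -
    have "X \<in> K"
      using meets_K[OF Ccells(1) kept_cells Ccells(2) X(1)] X(2) PK by blast
    then show ?thesis
    proof (cases "X \<in> \<Phi>")
      case True
      have "X \<inter> P = X"
        using face_of_disjoint_rel_interior[OF compat[OF True]] X(2) rel_interior_subset[of X] by blast
      then show ?thesis
        by blast
    qed (simp add: K_def)
  qed
  moreover have "\<Phi> \<subseteq> cells"
    using kept_cells unfolding K_def by blast
  ultimately show ?thesis
    using complete_complex_cells by blast
qed

text \<open>The delicate point is the fit of the three kinds of new cells. Cells containing
  \<open>p\<close> come from the arrangement alone; the old cells they run through are all in
  \<open>S\<close> by \<open>star\<close> and \<open>inP\<close>, hence cut by the same arrangement.
  Old cells left uncut never come near enough to \<open>P\<close> to meet the replaced
  region.\<close>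

lemma insert_cell:
  assumes \<Psi>: "complete_complex W \<Psi>" "\<Phi> \<subseteq> \<Psi>"
    and star: "\<And>X. X \<in> \<Psi> \<Longrightarrow> X \<inter> rel_interior P \<noteq> {} \<Longrightarrow> X \<inter> \<Union>\<Phi> \<subseteq> P"
    and inP: "\<And>X. X \<in> \<Psi> \<Longrightarrow> rel_interior X \<inter> P \<noteq> {} \<Longrightarrow> X \<subseteq> P"
  shows "\<exists>\<Psi>'. complete_complex W \<Psi>' \<and> insert P \<Phi> \<subseteq> \<Psi>'"
proof -
  note C\<Psi> = complete_complexD[OF \<Psi>(1)]
  note cpx = polytopal_complexD[OF C\<Psi>(1)]
  have convW: "convex W" "rel_interior W = W" "polyhedron W"
    using W by (auto simp: subspace_imp_affine affine_imp_convex rel_interior_affine affine_imp_polyhedron)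
  obtain p where p: "p \<in> rel_interior P"
    using P(3) rel_interior_eq_empty[OF convP] by blast
  have pP: "p \<in> P"
    using p rel_interior_subset by blast
  \<comment> \<open>These are the old cells that \<open>Q\<close> must not meet outside
    \<open>P\<close>; those meeting the relative interior of \<open>P\<close> are recut
    instead.\<close>
  let ?\<C> = "{C \<in> \<Psi>. C \<inter> rel_interior P = {}}"
  have bfC: "bounded_finite ?\<C>"
    unfolding bounded_finite_def
  proof
    fix r :: real
    have "finite {C \<in> \<Psi>. C \<inter> cball 0 r \<noteq> {}}"
      using C\<Psi>(3) unfolding bounded_finite_def by simp
    then show "finite {C \<in> ?\<C>. C \<inter> cball 0 r \<noteq> {}}"
      by (rule rev_finite_subset) auto
  qed
  have polyC: "polytope C \<and> C \<inter> rel_interior P = {}" if "C \<in> ?\<C>" for C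
    using that cpx(1) by auto
  obtain H where H: "finite H" "\<And>a b y. (a, b) \<in> H \<Longrightarrow> y \<in> P \<Longrightarrow> b \<le> a \<bullet> y"
    "W \<inter> sign_cell H p = P"
    "bounded {x \<in> W. \<forall>(a, b)\<in>H. b < a \<bullet> p \<longrightarrow> b \<le> a \<bullet> x}"
    "\<And>C. C \<in> ?\<C> \<Longrightarrow> {x \<in> W. \<forall>(a, b)\<in>H. b < a \<bullet> p \<longrightarrow> b \<le> a \<bullet> x} \<inter> C \<subseteq> P"
    by (rule thin_neighbourhood[OF W P(1,2) p bfC polyC], assumption) (rule that)
  define Q where "Q = {x \<in> W. \<forall>(a, b)\<in>H. b < a \<bullet> p \<longrightarrow> b \<le> a \<bullet> x}"
  have QP: "x \<in> P" if "x \<in> Q" "x \<in> C" "C \<in> \<Psi>" "C \<inter> rel_interior P = {}" for x C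
    using H(5)[of C] that unfolding Q_def by auto
  \<comment> \<open>Arrangement cells having \<open>p\<close> in their closure stay inside
    \<open>Q\<close>, which also makes their intersections with \<open>W\<close> bounded.\<close>
  have in_Q: "y \<in> Q" if "p \<in> sign_cell H x" "y \<in> W" "y \<in> sign_cell H x" for x y
  proof -
    have "b \<le> a \<bullet> y" if "(a, b) \<in> H" "b < a \<bullet> p" for a b
    proof -
      have "p \<in> side x (a, b)" "y \<in> side x (a, b)"
        using \<open>p \<in> sign_cell H x\<close> \<open>y \<in> sign_cell H x\<close> that(1) unfolding sign_cell_def by blast+
      then show ?thesis
        using that(2) by (auto simp: side_def)
    qed
    then show ?thesis
      using that(2) unfolding Q_def by auto
  qed
  have relP: "rel_interior P = W \<inter> open_sign_cell H p"
    using rel_interior_Int_sign_cell[OF H(1) convW(1), of p] convW(2) P(2) pP H(3) by auto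
  \<comment> \<open>Together with membership of \<open>y\<close> in the closed cell of
    \<open>p\<close>, the opposite membership would place \<open>y\<close> in the open cell, which
    is the relative interior of \<open>P\<close>.\<close>
  have boundary: "p \<notin> sign_cell H y" if "y \<in> P" "y \<notin> rel_interior P" for y
    using sign_cell_antisym[of y H p] relP H(3) that by blast
  \<comment> \<open>The carrier of a point: the unique old cell with the point in its relative
    interior.\<close>
  define car where "car x = (THE C. C \<in> \<Psi> \<and> x \<in> rel_interior C)" for x
  have cellul: "cellulation W \<Psi>"
    by (rule complete_complex_cellulation[OF \<Psi>(1)])
  have uniq: "C = C'" if "C \<in> \<Psi>" "C' \<in> \<Psi>" "x \<in> rel_interior C" "x \<in> rel_interior C'" for C C' x
    using cellul that unfolding cellulation_def by blast
  have car_eq: "car x = C" if "C \<in> \<Psi>" "x \<in> rel_interior C" for x C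
    unfolding car_def using that uniq by (intro the_equality) auto
  have car: "car x \<in> \<Psi>" "x \<in> rel_interior (car x)" "x \<in> car x" if x: "x \<in> W" for x
  proof -
    obtain C where "C \<in> \<Psi>" "x \<in> C"
      using C\<Psi>(4) x by blast
    then obtain C' where "C' \<in> \<Psi>" "x \<in> rel_interior C'"
      using cellul unfolding cellulation_def by meson
    then show "car x \<in> \<Psi>" "x \<in> rel_interior (car x)"
      using car_eq by auto
    then show "x \<in> car x"
      using rel_interior_subset by blast
  qed
  have carW: "car x \<subseteq> W" if "x \<in> W" for x
    using car(1)[OF that] C\<Psi>(4) by blast
  have car_mono: "car y \<subseteq> C" if "C \<in> \<Psi>" "y \<in> C" for y C
  proof -
    have "y \<in> W"
      using that C\<Psi>(4) by blast
    then show ?thesis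
      using polytopal_complex_subset_cell(1)[OF C\<Psi>(1) car(1) that(1)] car(2) that(2) by blast
  qed
  define S where "S = {C \<in> \<Psi>. C \<inter> \<Union>\<Phi> \<subseteq> P}"
  have S_sub: "C' \<in> S" if "C \<in> S" "C' \<in> \<Psi>" "C' \<subseteq> C" for C C'
    using that unfolding S_def by blast
  \<comment> \<open>Otherwise the point lies in \<open>Q\<close> and in an old cell avoiding the
    relative interior of \<open>P\<close>, hence on the relative boundary of \<open>P\<close>,
    contrary to \<open>boundary\<close>.\<close>
  have near: "car x \<inter> rel_interior P \<noteq> {}" if x: "x \<in> W" "p \<in> sign_cell H x" for x
  proof
    assume e: "car x \<inter> rel_interior P = {}"
    have "x \<in> Q"
      using in_Q[OF x(2,1)] sign_cell_self by blast
    then have "x \<in> P"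
      using QP car x e by blast
    moreover have "x \<notin> rel_interior P"
      using e car(3)[OF x(1)] by blast
    ultimately show False
      using boundary x(2) by blast
  qed
  have nearS: "car x \<in> S" if "x \<in> W" "p \<in> sign_cell H x" for x
    using star near[OF that] car(1)[OF that(1)] unfolding S_def by blast
  define d where "d x = (if p \<in> sign_cell H x then W \<inter> sign_cell H x
    else if car x \<in> S then car x \<inter> sign_cell H x else car x)" for x
  have d1: "d x = W \<inter> sign_cell H x" if "p \<in> sign_cell H x" for x
    using that by (simp add: d_def)
  have d2: "d x = car x \<inter> sign_cell H x" if "p \<notin> sign_cell H x" "car x \<in> S" for x
    using that by (simp add: d_def)
  have d3: "d x = car x" if "p \<notin> sign_cell H x" "car x \<notin> S" for x
    using that by (simp add: d_def)
  have rel1: "rel_interior (W \<inter> sign_cell H x) = W \<inter> open_sign_cell H x" if "x \<in> W" for x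
    using rel_interior_Int_sign_cell[OF H(1) convW(1), of x] convW(2) that by simp
  have rel2: "rel_interior (car x \<inter> sign_cell H x) = rel_interior (car x) \<inter> open_sign_cell H x"
    if "x \<in> W" for x
    using rel_interior_Int_sign_cell[OF H(1) cpx(3)] car that by blast
  have cell_d: "cellulation W (d ` W)"
  proof (rule cellulationI)
    show "polytope (d x)" if x: "x \<in> W" for x
    proof (cases "p \<in> sign_cell H x")
      case True
      then have "W \<inter> sign_cell H x \<subseteq> Q"
        using in_Q by blast
      then have "bounded (W \<inter> sign_cell H x)"
        using H(4) bounded_subset unfolding Q_def by blast
      moreover have "polyhedron (W \<inter> sign_cell H x)"
        using convW(3) polyhedron_sign_cell[OF H(1)] by simp
      ultimately show ?thesis
        unfolding d1[OF True] polytope_eq_bounded_polyhedron by simp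
    next
      case False
      have pc: "polytope (car x)"
        using cpx(1) car(1)[OF x] by blast
      moreover have "polytope (car x \<inter> sign_cell H x)"
        using pc polyhedron_sign_cell[OF H(1)] unfolding polytope_eq_bounded_polyhedron
        by (simp add: bounded_Int)
      ultimately show ?thesis
        using False by (simp add: d_def)
    qed
    show "d x \<subseteq> W" if "x \<in> W" for x
      using carW[OF that] unfolding d_def by auto
    show "x \<in> rel_interior (d x)" if "x \<in> W" for x
      using rel1[OF that] rel2[OF that] car(2)[OF that] sign_cell_self(1)[of x H] that
      unfolding d_def by simp
    show "d y = d x" if x: "x \<in> W" and y: "y \<in> rel_interior (d x)" for x y
    proof -
      consider "p \<in> sign_cell H x" | "p \<notin> sign_cell H x" "car x \<in> S" |
        "p \<notin> sign_cell H x" "car x \<notin> S"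
        by blast
      then show ?thesis
      proof cases
        case 1
        then have "y \<in> open_sign_cell H x"
          using y rel1[OF x] d1 by simp
        then show ?thesis
          using open_sign_cell_eq(2)[of y H x] 1 d1 by simp
      next
        case 2
        then have "y \<in> open_sign_cell H x" "y \<in> rel_interior (car x)"
          using y rel2[OF x] d2 by auto
        then have "sign_cell H y = sign_cell H x" "car y = car x"
          using open_sign_cell_eq(2)[of y H x] car_eq[OF car(1)[OF x]] by auto
        then show ?thesis
          by (simp add: d_def)
      next
        case 3
        then have "y \<in> rel_interior (car x)"
          using y d3 by simp
        then have cy: "car y = car x" "y \<in> W"
          using car_eq[OF car(1)[OF x]] carW[OF x] rel_interior_subset[of "car x"] by auto
        then have "p \<notin> sign_cell H y"
          using nearS[of y] 3(2) by auto
        then show ?thesis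
          using 3 cy by (simp add: d_def)
      qed
    qed
    show "d y \<subseteq> d x" if x: "x \<in> W" and y: "y \<in> d x" for x y
    proof -
      have yW: "y \<in> W"
        using x y carW[OF x] unfolding d_def by (auto split: if_splits)
      consider "p \<in> sign_cell H x" | "p \<notin> sign_cell H x" "car x \<in> S" |
        "p \<notin> sign_cell H x" "car x \<notin> S"
        by blast
      then show ?thesis
      proof cases
        case 1
        then have ys: "y \<in> sign_cell H x"
          using y d1 by simp
        then have sub: "sign_cell H y \<subseteq> sign_cell H x"
          by (rule sign_cell_mono)
        \<comment> \<open>An uncut carrier could stick out of the arrangement cell. A carrier
          missing the relative interior of \<open>P\<close> lies inside \<open>P\<close>, since
          \<open>y\<close> is in \<open>Q\<close> and so in \<open>P\<close>; any other carrier is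
          in \<open>S\<close> by \<open>star\<close>.\<close>
        have "car y \<in> S"
        proof (cases "car y \<inter> rel_interior P = {}")
          case True
          have "y \<in> P"
            using QP[OF in_Q[OF 1 yW ys] car(3,1)[OF yW] True] .
          then have "car y \<subseteq> P"
            using inP[OF car(1)[OF yW]] car(2)[OF yW] by blast
          then show ?thesis
            using car(1)[OF yW] unfolding S_def by blast
        next
          case False
          then show ?thesis
            using star car(1)[OF yW] unfolding S_def by blast
        qed
        then show ?thesis
          unfolding d1[OF 1] using sub carW[OF yW] by (auto simp: d_def)
      next
        case 2
        then have y': "y \<in> car x" "y \<in> sign_cell H x"
          using y d2 by auto
        have sub: "sign_cell H y \<subseteq> sign_cell H x" "car y \<subseteq> car x"
          using sign_cell_mono[OF y'(2)] car_mono[OF car(1)[OF x] y'(1)] by auto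
        then have "p \<notin> sign_cell H y" "car y \<in> S"
          using 2 S_sub[OF 2(2) car(1)[OF yW]] by auto
        then show ?thesis
          unfolding d2[OF 2] using sub by (auto simp: d_def)
      next
        case 3
        then have sub: "car y \<subseteq> car x"
          using y d3 car_mono[OF car(1)[OF x]] by auto
        \<comment> \<open>If \<open>y\<close> were in the replaced region, its carrier, and with it
          \<open>car x\<close>, would meet the relative interior of \<open>P\<close>, so
          \<open>car x\<close> would be in \<open>S\<close>.\<close>
        have "p \<notin> sign_cell H y"
        proof
          assume "p \<in> sign_cell H y"
          then have "car x \<inter> rel_interior P \<noteq> {}"
            using near[OF yW] sub by blast
          then show False
            using 3(2) star car(1)[OF x] unfolding S_def by blast
        qed
        then show ?thesis
          unfolding d3[OF 3] using sub by (auto simp: d_def)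
      qed
    qed
    show "bounded_finite (d ` W)"
      unfolding bounded_finite_def
    proof
      fix r :: real
      let ?N = "{C \<in> \<Psi>. C \<inter> cball 0 r \<noteq> {}}"
      let ?R = "(\<lambda>k. W \<inter> k) ` range (sign_cell H) \<union>
        ((\<lambda>(C, k). C \<inter> k) ` (?N \<times> range (sign_cell H)) \<union> ?N)"
      have "finite ?N"
        using C\<Psi>(3) unfolding bounded_finite_def by simp
      then have "finite ?R"
        using finite_sign_cells[OF H(1)] by simp
      moreover have "{C \<in> d ` W. C \<inter> cball 0 r \<noteq> {}} \<subseteq> ?R"
      proof
        fix C assume "C \<in> {C \<in> d ` W. C \<inter> cball 0 r \<noteq> {}}"
        then obtain x where x: "x \<in> W" "C = d x" "d x \<inter> cball 0 r \<noteq> {}"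
          by blast
        show "C \<in> ?R"
        proof (cases "p \<in> sign_cell H x")
          case True
          show ?thesis
            unfolding x(2) d1[OF True] by (intro UnI1 imageI rangeI)
        next
          case False
          then have "d x \<subseteq> car x"
            unfolding d_def by auto
          then have "car x \<in> ?N"
            using x(3) car(1)[OF x(1)] by blast
          then have R1: "car x \<in> ?R"
            by (intro UnI2)
          have R2: "car x \<inter> sign_cell H x \<in> ?R"
          proof (rule UnI2, rule UnI1)
            show "car x \<inter> sign_cell H x \<in> (\<lambda>(C, k). C \<inter> k) ` (?N \<times> range (sign_cell H))"
              using \<open>car x \<in> ?N\<close>
              by (intro image_eqI[of _ _ "(car x, sign_cell H x)"] SigmaI rangeI) simp_all
          qed
          show ?thesis
          proof (cases "car x \<in> S")
            case True
            show ?thesis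
              unfolding x(2) d2[OF False True] by (rule R2)
          next
            case nS: False
            show ?thesis
              unfolding x(2) d3[OF False nS] by (rule R1)
          qed
        qed
      qed
      ultimately show "finite {C \<in> d ` W. C \<inter> cball 0 r \<noteq> {}}"
        by (rule rev_finite_subset)
    qed
  qed
  have "d p = P"
    using d1[OF sign_cell_self(2)] H(3) by simp
  then have PD: "P \<in> d ` W"
    using pP P(2) by blast
  have \<Phi>D: "F \<in> d ` W" if F: "F \<in> \<Phi>" for F
  proof -
    have F\<Psi>: "F \<in> \<Psi>" "convex F" "F \<noteq> {}"
      using F \<Psi>(2) cpx(3) C\<Psi>(2) by auto
    then obtain y where y: "y \<in> rel_interior F"
      using rel_interior_eq_empty by blast
    then have yF: "y \<in> F" "y \<in> W" "car y = F"
      using rel_interior_subset[of F] cpx(2)[OF F\<Psi>(1)] car_eq[OF F\<Psi>(1)] by auto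
    have "d y = F"
    proof (cases "F \<in> S")
      case True
      then have FP: "F \<subseteq> P"
        using F unfolding S_def by blast
      then have np: "p \<notin> sign_cell H y"
        using boundary[of y] disj[OF F] yF(1) by blast
      \<comment> \<open>Each hyperplane of \<open>H\<close> has \<open>P\<close>, hence
        \<open>F\<close>, on one closed side. Since \<open>y\<close> is a relative interior point of
        \<open>F\<close>, a hyperplane through \<open>y\<close> contains all of \<open>F\<close>, so
        no hyperplane cuts \<open>F\<close>.\<close>
      have "z \<in> side y (a, b)" if z: "z \<in> F" and ab: "(a, b) \<in> H" for z a b
        using supporting_at_rel_interior[OF F\<Psi>(2) y, of b a z] H(2)[OF ab] FP z yF(1)
        unfolding side_cases by (auto simp: subset_iff dest: leD)
      then have "F \<subseteq> sign_cell H y"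
        unfolding sign_cell_def by auto
      then show ?thesis
        using d2[OF np] yF(3) True by auto
    next
      case False
      then have "p \<notin> sign_cell H y"
        using nearS[OF yF(2)] yF(3) by auto
      then show ?thesis
        using d3 yF(3) False by simp
    qed
    then show ?thesis
      using yF(2) by blast
  qed
  \<comment> \<open>A last coning makes the cellulation face-to-face; \<open>P\<close> and the
    members of \<open>\<Phi>\<close> are kept whole and survive as cells.\<close>
  define c where "c C = (SOME x. x \<in> rel_interior C)" for C :: "'a set"
  interpret coning W "d ` W" "insert P \<Phi>" c
  proof unfold_locales
    show "c C \<in> rel_interior C" if "C \<in> d ` W" "C \<notin> insert P \<Phi>" for C
    proof -
      have "convex C" "C \<noteq> {}"
        using cell_d that(1) polytope_imp_convex unfolding cellulation_def by auto
      then show ?thesis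
        unfolding c_def using rel_interior_eq_empty some_in_eq by blast
    qed
    show "G \<in> insert P \<Phi>" if "F \<in> insert P \<Phi>" "G face_of F" "G \<noteq> {}" for F G
      using that Pface \<Phi>face by auto
  qed (use cell_d PD \<Phi>D in auto)
  show ?thesis
    using complete_complex_cells kept_cells by blast
qed

lemma insert_cell_complete:
  assumes "complete_complex W \<Psi>" "\<Phi> \<subseteq> \<Psi>"
  shows "\<exists>\<Psi>'. complete_complex W \<Psi>' \<and> insert P \<Phi> \<subseteq> \<Psi>'"
proof -
  obtain \<Psi>1 where 1: "complete_complex W \<Psi>1" "\<Phi> \<subseteq> \<Psi>1" "\<forall>X\<in>\<Psi>1. X \<inter> P face_of X"
    using subdivide_along[OF assms] by (elim exE conjE)
  obtain \<Psi>2 where 2: "complete_complex W \<Psi>2" "\<Phi> \<subseteq> \<Psi>2"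
    "\<forall>X\<in>\<Psi>2. X \<inter> rel_interior P \<noteq> {} \<longrightarrow> X \<inter> \<Union>\<Phi> \<subseteq> P"
    "\<forall>X\<in>\<Psi>2. rel_interior X \<inter> P \<noteq> {} \<longrightarrow> X \<subseteq> P"
    using subdivide_full[OF 1] by (elim exE conjE)
  show ?thesis
    by (rule insert_cell[OF 2(1,2)]) (use 2(3,4) in simp_all)
qed

end

section \<open>Existence of completions\<close>

text \<open>The starting point of the induction: the cube grid, coned with no cell kept.\<close>

lemma exists_complete_complex:
  fixes W :: "'a::euclidean_space set"
  assumes "subspace W"
  shows "\<exists>\<Psi>. complete_complex W \<Psi>"
proof -
  obtain D where D: "cellulation W D"
    using cellulation_grid[OF assms] by blast
  define c where "c C = (SOME x. x \<in> rel_interior C)" for C :: "'a set"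
  interpret coning W D "{}" c
  proof unfold_locales
    show "c C \<in> rel_interior C" if "C \<in> D" for C
    proof -
      have "convex C" "C \<noteq> {}"
        using D that polytope_imp_convex unfolding cellulation_def by auto
      then show ?thesis
        unfolding c_def using rel_interior_eq_empty some_in_eq by blast
    qed
  qed (use D in auto)
  show ?thesis
    using complete_complex_cells by blast
qed

lemma polytopal_complex_subset:
  assumes \<Phi>: "polytopal_complex W \<Phi>" and sub: "\<Psi> \<subseteq> \<Phi>"
    and face: "\<And>F G. F \<in> \<Psi> \<Longrightarrow> G face_of F \<Longrightarrow> G \<noteq> {} \<Longrightarrow> G \<in> \<Psi>"
  shows "polytopal_complex W \<Psi>"
proof (rule polytopal_complexI)
  show "polytope X \<and> X \<subseteq> W" if "X \<in> \<Psi>" for X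
    using polytopal_complexD(1,2)[OF \<Phi>, of X] that sub by (simp add: subsetD)
  show "X = Y" if XY: "X \<in> \<Psi>" "Y \<in> \<Psi>" "rel_interior X \<inter> rel_interior Y \<noteq> {}" for X Y
  proof (rule subset_antisym)
    have "X \<in> \<Phi>" "Y \<in> \<Phi>"
      using XY sub by auto
    then show "X \<subseteq> Y" "Y \<subseteq> X"
      using polytopal_complex_subset_cell(1)[OF \<Phi>] XY(3) rel_interior_subset[of X]
        rel_interior_subset[of Y] by blast+
  qed
qed (fact face)

text \<open>A cell of maximal dimension is a proper face of no other cell, so removing it leaves a
  complex that contains all its proper nonempty faces. Completing this smaller complex and inserting
  the removed cell gives the induction step.\<close>

lemma complete_complex_extending:
  fixes W :: "'a::euclidean_space set"
  assumes W: "subspace W" and "finite \<Phi>" "polytopal_complex W \<Phi>" "{} \<notin> \<Phi>"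
  shows "\<exists>\<Psi>. complete_complex W \<Psi> \<and> \<Phi> \<subseteq> \<Psi>"
  using assms(2-)
proof (induction \<Phi> rule: finite_psubset_induct)
  case (psubset \<Phi>)
  note cpx = polytopal_complexD[OF psubset.prems(1)]
  show ?case
  proof (cases "\<Phi> = {}")
    case True
    then show ?thesis
      using exists_complete_complex[OF W] by blast
  next
    case False
    then have "Max (aff_dim ` \<Phi>) \<in> aff_dim ` \<Phi>"
      using psubset.hyps by (intro Max_in) auto
    then obtain P where P: "P \<in> \<Phi>" and "aff_dim P = Max (aff_dim ` \<Phi>)"
      by auto
    then have dim: "aff_dim F \<le> aff_dim P" if "F \<in> \<Phi>" for F
      using psubset.hyps that by simp
    have max: "P = F" if "F \<in> \<Phi>" "P face_of F" for F
      using face_of_aff_dim_lt[OF cpx(3)[OF that(1)] that(2)] dim[OF that(1)] by fastforce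
    let ?\<Phi> = "\<Phi> - {P}"
    have face: "G \<in> ?\<Phi>" if "F \<in> ?\<Phi>" "G face_of F" "G \<noteq> {}" for F G
    proof -
      have F: "F \<in> \<Phi>" "F \<noteq> P"
        using that(1) by auto
      have "G \<noteq> P"
        using max[OF F(1)] that(2) F(2) by metis
      then show ?thesis
        using cpx(4)[OF F(1) that(2,3)] by simp
    qed
    have "polytopal_complex W ?\<Phi>"
      by (rule polytopal_complex_subset[OF psubset.prems(1) Diff_subset face])
    then obtain \<Psi> where \<Psi>: "complete_complex W \<Psi>" "?\<Phi> \<subseteq> \<Psi>"
      using psubset.IH[of ?\<Phi>] P psubset.prems(2) by auto
    interpret cell_insertion W ?\<Phi> P
    proof unfold_locales
      show "F \<inter> rel_interior P = {}" if "F \<in> ?\<Phi>" for F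
      proof -
        have F: "F \<in> \<Phi>" "F \<noteq> P"
          using that by auto
        then show ?thesis
          using polytopal_complex_subset_cell(2)[OF psubset.prems(1) P F(1)] max[OF F(1)] by blast
      qed
      show "F \<inter> P face_of F" if "F \<in> ?\<Phi>" for F
        using cpx(5)[of F P] P that by simp
      show "F \<in> ?\<Phi>" if "F face_of P" "F \<noteq> P" "F \<noteq> {}" for F
        using cpx(4)[OF P that(1,3)] that(2) by simp
      show "{} \<notin> ?\<Phi>" "P \<noteq> {}"
        using psubset.prems(2) P by auto
    qed (fact W face cpx(1)[OF P] cpx(2)[OF P])+
    have "insert P ?\<Phi> = \<Phi>"
      using \<open>P \<in> \<Phi>\<close> by blast
    then show ?thesis
      using insert_cell_complete[OF \<Psi>] by simp
  qed
qed

theorem theorem1p2: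
  fixes W :: "'a::euclidean_space set" and \<Phi> :: "'a set set"
  assumes "subspace W"
    and "finite \<Phi>"
    and "polytopal_complex W \<Phi>"
  shows "\<exists>\<Psi>. polytopal_completion W \<Phi> \<Psi> \<and> locally_finite_in (top_of_set W) \<Psi>"
proof -
  note cpx = polytopal_complexD[OF assms(3)]
  \<comment> \<open>The construction excludes the empty polyhedron, so it is removed here.\<close>
  have "polytopal_complex W (\<Phi> - {{}})"
    by (rule polytopal_complex_subset[OF assms(3) Diff_subset]) (use cpx(4) in blast)
  then obtain \<Psi>0 where \<Psi>0: "complete_complex W \<Psi>0" "\<Phi> - {{}} \<subseteq> \<Psi>0"
    using complete_complex_extending[OF assms(1), of "\<Phi> - {{}}"] assms(2) by blast
  note C = complete_complexD[OF \<Psi>0(1)]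
  \<comment> \<open>The union with \<open>\<Phi>\<close> restores the empty polyhedron if it was a
    member, and adds nothing else.\<close>
  define \<Psi> where "\<Psi> = \<Psi>0 \<union> \<Phi>"
  have \<Psi>: "X \<in> \<Psi>0 \<or> X = {}" if "X \<in> \<Psi>" for X
    using that \<Psi>0(2) unfolding \<Psi>_def by blast
  have complex: "polytopal_complex W \<Psi>"
  proof (rule polytopal_complexI)
    show "polytope X \<and> X \<subseteq> W" if "X \<in> \<Psi>" for X
      using \<Psi>[OF that] polytopal_complexD(1,2)[OF C(1)] by (auto simp: polytope_empty)
    show "F \<in> \<Psi>" if "X \<in> \<Psi>" "F face_of X" "F \<noteq> {}" for X F
      using \<Psi>[OF that(1)] polytopal_complexD(4)[OF C(1) _ that(2,3)] that(2,3)
      unfolding \<Psi>_def by auto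
    show "X = Y" if "X \<in> \<Psi>" "Y \<in> \<Psi>" "rel_interior X \<inter> rel_interior Y \<noteq> {}" for X Y
    proof -
      have "X \<in> \<Psi>0" "Y \<in> \<Psi>0"
        using \<Psi> that by fastforce+
      then show ?thesis
        using complete_complex_cellulation[OF \<Psi>0(1)] that(3) unfolding cellulation_def by simp
    qed
  qed
  have union: "\<Union>\<Psi> = W"
    using C(4) cpx(2) unfolding \<Psi>_def by auto
  have "locally_finite_in (top_of_set W) \<Psi>"
    unfolding locally_finite_in_def
  proof (intro conjI ballI)
    show "\<Union>\<Psi> \<subseteq> topspace (top_of_set W)"
      using union by simp
    fix x assume "x \<in> topspace (top_of_set W)"
    moreover have "finite {U \<in> \<Psi>0. U \<inter> ball x 1 \<noteq> {}}"
      by (rule bounded_finiteD[OF C(3)]) simp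
    then have "finite {U \<in> \<Psi>. U \<inter> (W \<inter> ball x 1) \<noteq> {}}"
      by (rule rev_finite_subset) (use \<Psi> in blast)
    ultimately show "\<exists>V. openin (top_of_set W) V \<and> x \<in> V \<and> finite {U \<in> \<Psi>. U \<inter> V \<noteq> {}}"
      by (intro exI[of _ "W \<inter> ball x 1"]) (auto simp: openin_open_Int)
  qed
  moreover have "\<Phi> \<subseteq> \<Psi>"
    unfolding \<Psi>_def by blast
  ultimately show ?thesis
    using complex union assms(3)
    unfolding polytopal_completion_def completion_def subcomplex_def polytopal_complex_def by blast
qed

end
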